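(* Consider the interference-limited cellular network (noise power $\sigma_z^2=0$) described in the context, with $\alpha=\beta$. The $\mathsf{SINR}$ outage probability $\mathsf{O}_B(c)=\mathbb{P}[\mathsf{SINR}_B(c)\le\tau]$, $\tau>0$, of a typical cellular user on channel $c\in\mathcal{C}$ is $$\mathsf{O}_B(c)=\begin{cases}1-\dfrac{\pi\lambda_B}{\pi\lambda_B(1+\mathcal{K}_2)+\left(\frac{\rho_d}{P_B}\right)^{2/\beta}\mathcal{K}_3}, & c\in\mathcal{C}_D,\\[3mm] 1-\exp\left[-\left(\mathcal{K}_2+\left(\frac{\rho_d}{\rho_b}\right)^{2/\beta}\mathcal{K}_3\right)\right], & c\in\mathcal{C}_U,\end{cases}$$ where $$\mathcal{K}_2=\frac{2\hat q}{\alpha-2}\,\mathcal{G}\left[\left(\frac1\tau\right)^{\frac1\alpha},\alpha\right]\tau^{\frac2\alpha},\qquad \mathcal{K}_3=\frac{2\pi^2p_sp_f\lambda_D d_o^2}{\beta\sin\left(\frac{2\pi}{\beta}\right)}\tau^{\frac2\beta}\cdot\mathbf{1}_{c=c_d},$$ $\hat q=q_c$ for $c\in\mathcal{C}\setminus\{c_d\}$ and $\hat q=q_d$ for $c=c_d$, and $\mathcal{G}[y,\alpha]=y^{2-\alpha}\,{}_2F_1\left[1,\frac{\alpha-2}{\alpha};\frac{2\alpha-2}{\alpha};-y^{-\alpha}\right]$ with ${}_2F_1$ the Gauss hypergeometric function.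
   Context: Parameters (all positive reals): densities $\lambda_B,\lambda_U,\lambda_D$ of base stations (BSs), cellular users, D2D transmitters; BS transmit power $P_B$; receiver sensitivities $\rho_b$ (BS) and $\rho_d$ (D2D); sensing threshold $\gamma$; D2D link distance $d_o$; path-loss exponents $\alpha>2$ (cellular transmitters) and $\beta>2$ (D2D transmitters); RF-to-DC efficiency $a\in(0,1]$. PPP means Poisson point process on $\mathbb{R}^2$. All fading power gains $h$ are i.i.d. $\mathrm{Exp}(1)$, independent of everything else. Channels: a finite set $\mathcal{C}$, $|\mathcal{C}|\ge2$, is the disjoint union of $\mathcal{C}_D$ (downlink) and $\mathcal{C}_U$ (uplink); $c_d\in\mathcal{C}$ is the D2D channel. Number of users per BS: $N_u$ has pmf $\mathbb{P}\{N_u=n\}=\frac{b^b}{\Gamma(b)}\frac{\Gamma(n+b)}{\Gamma(n+1)}\frac{m^n}{(b+m)^{n+b}}$, $n\ge 0$, with $b=3.575$, $m=\lambda_U/\lambda_B$. Access probabilities ($q_c$ for a channel other than $c_d$, $q_d$ for $c_d$): under the random spectrum access (RSA) policy $q_c=q_d=1-\sum_{n=0}^{|\mathcal{C}|-1}\frac{|\mathcal{C}|-n}{|\mathcal{C}|}\mathbb{P}\{N_u=n\}$; under the prioritized spectrum access (PSA) policy $q_c=1-\sum_{n=0}^{|\mathcal{C}|-1}\frac{|\mathcal{C}|-n-1}{|\mathcal{C}|-1}\mathbb{P}\{N_u=n\}$ and $q_d=1-\sum_{n=0}^{|\mathcal{C}|-1}\mathbb{P}\{N_u=n\}$. The result holds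 for either policy. Uplink user power (channel inversion to the nearest BS): $P_u=\rho_b R^{\alpha}$ with $R$ of density $2\pi\lambda_B r e^{-\pi\lambda_B r^2}$, $r>0$, so $\mathbb{E}[P_u^{2/\alpha}]=\rho_b^{2/\alpha}/(\pi\lambda_B)$; powers of different users are independent. Each D2D transmitter has power $P_D=\rho_d d_o^{\beta}$. $p_f$ is the probability that a D2D transmitter at the origin finds $c_d$ free: transmitters using $c_d$ (BSs of power $P=P_B$ if $c_d\in\mathcal{C}_D$, users of i.i.d. random powers $P$ distributed as $P_u$ if $c_d\in\mathcal{C}_U$) form a PPP of intensity $q_d\lambda_B$, and $c_d$ is free iff no such transmitter $x$ has $P h_x\|x\|^{-\alpha}>\gamma$. $p_s=\mathbb{P}[P_{\rm H}>P_D]$, where the harvested power is $P_{\rm H}=a\sum_{x\in\tilde\Phi_B}\sum_{c\in\mathcal{C}_D}P_B h_{x,c}\|x\|^{-\alpha}+a\sum_{u\in\Phi_U'}P_u h_u\|u\|^{-\alpha}$, with independent PPPs $\tilde\Phi_B$ of intensity $q_c^{\rm D}\lambda_B$ and $\Phi_U'$ of intensity $q_c^{\rm U}|\mathcal{C}_U|\lambda_B$ with i.i.d. powers distributed as $P_u$; here $q_c^{\rm D}=1-\sum_{n=0}^{|\mathcal{C}_D|-1}\frac{|\mathcal{C}_D|-n}{|\mathcal{C}_D|}\mathbb{P}\{N_u=n\}$, and $q_c^{\rm U}$ is the same with $|\mathcal{C}_U|$ in place of $|\mathcal{C}_D|$. SINR model (receiver at the origin, zero noise): - Downlink, $c\in\mathcal{C}_D$: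 $\mathsf{SINR}_B(c)=\frac{P_Bh\,r_0^{-\alpha}}{I_B^{\rm D}(c)+I_D\mathbf{1}_{c=c_d}}$, where $h\sim\mathrm{Exp}(1)$, the distance $r_0$ to the serving (nearest) BS has density $2\pi\lambda_B r e^{-\pi\lambda_B r^2}$, and, given $r_0$, $I_B^{\rm D}(c)=\sum_x P_Bh_x\|x\|^{-\alpha}$ over a PPP of intensity $\hat q\lambda_B$ restricted to $\|x\|>r_0$. - Uplink, $c\in\mathcal{C}_U$: $\mathsf{SINR}_B(c)=\frac{\rho_bh}{I_B^{\rm U}(c)+I_D\mathbf{1}_{c=c_d}}$, where $h\sim\mathrm{Exp}(1)$ and $I_B^{\rm U}(c)=\sum_u P_u h_u\|u\|^{-\alpha}$ over those points $u$ of a PPP of intensity $\hat q\lambda_B$, with i.i.d. power marks $P_u$ (independent of the point locations), each distributed as $\rho_b R^{\alpha}$ with $R$ of density $2\pi\lambda_B r e^{-\pi\lambda_B r^2}$, $r>0$, that satisfy $\|u\|\ge(P_u/\rho_b)^{1/\alpha}$. - In both cases $I_D=\sum_yP_Dh_y\|y\|^{-\beta}$ over an independent PPP of intensity $p_sp_f\lambda_D$ on all of $\mathbb{R}^2$. The variables $h$, $I_D$ and the cellular interference are independent (given $r_0$ in the downlink). An SINR with zero denominator is taken to be $+\infty$. *)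

theory Defs
  imports "HOL-Probability.Probability"
begin

section \<open>The Gauss hypergeometric function\<close>

text \<open>
  The principal branch: the value at \<open>z\<close> of the analytic continuation of the hypergeometric
  series from the unit disc to the plane slit along \<open>[1, \<infinity>)\<close>.  Continuation is needed, since
  the argument \<open>-\<tau>\<close> relevant below is an arbitrary negative real.
\<close>

definition hyp2F1 :: "complex \<Rightarrow> complex \<Rightarrow> complex \<Rightarrow> complex \<Rightarrow> complex" where
  "hyp2F1 a b c z =
     (THE w. \<exists>f. f holomorphic_on (- (of_real ` {1..})) \<and>
                 (\<forall>u\<in>ball 0 1. (\<lambda>n. fps_nth (fps_hypergeo [a, b] [c] 1) n * u ^ n) sums f u) \<and>
                 w = f z)"

text \<open>\<open>hyp2F1\<close> is real for real parameters and real argument below 1, so \<open>Re\<close> loses nothing.\<close>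

definition G_fun :: "real \<Rightarrow> real \<Rightarrow> real" where
  "G_fun y \<alpha> = y powr (2 - \<alpha>) *
     Re (hyp2F1 1 (of_real ((\<alpha> - 2) / \<alpha>)) (of_real ((2 * \<alpha> - 2) / \<alpha>)) (of_real (- (y powr (- \<alpha>)))))"


section \<open>Spectrum access\<close>

definition num_users_prob :: "real \<Rightarrow> real \<Rightarrow> nat \<Rightarrow> real" where
  "num_users_prob lamB lamU n =
     (let b = 3.575; m = lamU / lamB in
        b powr b / Gamma b * (Gamma (real n + b) / Gamma (real n + 1)) *
        (m ^ n / (b + m) powr (real n + b)))"

text \<open>
  Probability that a given one of \<open>K\<close> channels is used by a base station which assigns
  its channels to its users uniformly at random.
\<close>

definition uniform_access_prob :: "real \<Rightarrow> real \<Rightarrow> nat \<Rightarrow> real" where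
  "uniform_access_prob lamB lamU K =
     1 - (\<Sum>n<K. (real K - real n) / real K * num_users_prob lamB lamU n)"

datatype policy = RSA | PSA

fun access_prob_other :: "policy \<Rightarrow> real \<Rightarrow> real \<Rightarrow> nat \<Rightarrow> real" where
  "access_prob_other RSA lamB lamU K = uniform_access_prob lamB lamU K"
| "access_prob_other PSA lamB lamU K =
     1 - (\<Sum>n<K. (real K - real n - 1) / (real K - 1) * num_users_prob lamB lamU n)"

fun access_prob_d2d :: "policy \<Rightarrow> real \<Rightarrow> real \<Rightarrow> nat \<Rightarrow> real" where
  "access_prob_d2d RSA lamB lamU K = uniform_access_prob lamB lamU K"
| "access_prob_d2d PSA lamB lamU K = 1 - (\<Sum>n<K. num_users_prob lamB lamU n)"


section \<open>Marked Poisson point processes\<close>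

text \<open>
  A random variable on \<open>M\<close> generates a \<open>\<sigma>\<close>-algebra.  Independence of variables with
  values in different types is independence of the \<open>\<sigma>\<close>-algebras they generate.
\<close>

definition gen_sets :: "'w measure \<Rightarrow> 'a measure \<Rightarrow> ('w \<Rightarrow> 'a) \<Rightarrow> 'w set set" where
  "gen_sets M N X = {X -` A \<inter> space M | A. A \<in> sets N}"

definition mutually_indep :: "'w measure \<Rightarrow> 'w set set list \<Rightarrow> bool" where
  "mutually_indep M Fs \<longleftrightarrow> prob_space.indep_sets M (\<lambda>i. Fs ! i) {..<length Fs}"

text \<open>
  A configuration \<open>(N, X)\<close> consists of the points \<open>X n\<close> with \<open>n < N\<close>, where \<open>N\<close> may be
  finite (this covers intensity zero) or infinite.  Entries \<open>X n\<close> with \<open>n \<ge> N\<close> are irrelevant.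
\<close>

type_synonym 'a config = "enat \<times> (nat \<Rightarrow> 'a)"

definition config_space :: "'a measure \<Rightarrow> 'a config measure" where
  "config_space S = count_space UNIV \<Otimes>\<^sub>M (\<Pi>\<^sub>M n\<in>UNIV. S)"

definition points :: "'a config \<Rightarrow> 'a set" where
  "points \<phi> = snd \<phi> ` {n. enat n < fst \<phi>}"

definition point_sum :: "('a \<Rightarrow> ennreal) \<Rightarrow> 'a config \<Rightarrow> ennreal" where
  "point_sum f \<phi> = (\<Sum>n. if enat n < fst \<phi> then f (snd \<phi> n) else 0)"

definition count_in :: "'a set \<Rightarrow> 'a config \<Rightarrow> ennreal" where
  "count_in A = point_sum (indicator A)"

definition poisson_process :: "'w measure \<Rightarrow> 'a measure \<Rightarrow> ('w \<Rightarrow> 'a config) \<Rightarrow> bool" where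
  "poisson_process M \<Lambda> \<Phi> \<longleftrightarrow>
     prob_space M \<and>
     \<Phi> \<in> M \<rightarrow>\<^sub>M config_space \<Lambda> \<and>
     (\<forall>A\<in>sets \<Lambda>. emeasure \<Lambda> A < \<infinity> \<longrightarrow>
        (\<forall>k. measure M {\<omega> \<in> space M. count_in A (\<Phi> \<omega>) = of_nat k} =
              exp (- measure \<Lambda> A) * measure \<Lambda> A ^ k / fact k)) \<and>
     (\<forall>(A :: nat \<Rightarrow> 'a set) m.
        (\<forall>i<m. A i \<in> sets \<Lambda>) \<and> disjoint_family_on A {..<m} \<longrightarrow>
        prob_space.indep_vars M (\<lambda>_. borel) (\<lambda>i \<omega>. count_in (A i) (\<Phi> \<omega>)) {..<m})"

definition iid :: "'w measure \<Rightarrow> 'a measure \<Rightarrow> (nat \<Rightarrow> 'w \<Rightarrow> 'a) \<Rightarrow> bool" where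
  "iid M Q X \<longleftrightarrow> prob_space.indep_vars M (\<lambda>_. Q) X UNIV \<and> (\<forall>n. distr M Q (X n) = Q)"

definition locations :: "('a \<times> 'm) config \<Rightarrow> 'a config" where
  "locations \<phi> = (fst \<phi>, \<lambda>n. fst (snd \<phi> n))"

definition marks :: "('a \<times> 'm) config \<Rightarrow> nat \<Rightarrow> 'm" where
  "marks \<phi> = (\<lambda>n. snd (snd \<phi> n))"

text \<open>
  A homogeneous Poisson process of intensity \<open>lam\<close> on the plane, whose points carry i.i.d. marks
  of law \<open>Q\<close> that are independent of the locations.
\<close>

definition marked_ppp ::
    "'w measure \<Rightarrow> real \<Rightarrow> 'm measure \<Rightarrow> ('w \<Rightarrow> ((real ^ 2) \<times> 'm) config) \<Rightarrow> bool" where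
  "marked_ppp M lam Q \<Phi> \<longleftrightarrow>
     \<Phi> \<in> M \<rightarrow>\<^sub>M config_space (borel \<Otimes>\<^sub>M Q) \<and>
     poisson_process M (scale_measure (ennreal lam) lborel) (\<lambda>\<omega>. locations (\<Phi> \<omega>)) \<and>
     iid M Q (\<lambda>n \<omega>. marks (\<Phi> \<omega>) n) \<and>
     mutually_indep M
       [gen_sets M (config_space borel) (\<lambda>\<omega>. locations (\<Phi> \<omega>)),
        gen_sets M (\<Pi>\<^sub>M n\<in>UNIV. Q) (\<lambda>\<omega>. marks (\<Phi> \<omega>))]"


section \<open>Fading and transmit powers\<close>

definition fading_law :: "real measure" where
  "fading_law = density lborel (\<lambda>x. ennreal (exponential_density 1 x))"

definition nearest_bs_law :: "real \<Rightarrow> real measure" where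
  "nearest_bs_law lamB =
     density lborel (\<lambda>r. ennreal (if 0 < r then 2 * pi * lamB * r * exp (- pi * lamB * r\<^sup>2) else 0))"

definition user_power_law :: "real \<Rightarrow> real \<Rightarrow> real \<Rightarrow> real measure" where
  "user_power_law \<alpha> lamB rho = distr (nearest_bs_law lamB) borel (\<lambda>r. rho * r powr \<alpha>)"


section \<open>Sensing and energy harvesting\<close>

text \<open>The marks are pairs of transmit power and fading gain; \<open>Pw\<close> is the law of the power.\<close>

definition sensing_model ::
    "'w measure \<Rightarrow> real \<Rightarrow> real measure \<Rightarrow> ('w \<Rightarrow> ((real ^ 2) \<times> real \<times> real) config) \<Rightarrow> bool" where
  "sensing_model M lam Pw \<Phi> \<longleftrightarrow> marked_ppp M lam (Pw \<Otimes>\<^sub>M fading_law) \<Phi>"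

definition channel_free :: "real \<Rightarrow> real \<Rightarrow> ((real ^ 2) \<times> real \<times> real) config \<Rightarrow> bool" where
  "channel_free \<alpha> \<gamma> \<phi> \<longleftrightarrow> \<not> (\<exists>(x, P, h)\<in>points \<phi>. P * h * norm x powr (- \<alpha>) > \<gamma>)"

text \<open>
  The mark of a base station is its family of fading gains over the downlink channels,
  that of a user is its pair of transmit power and fading gain.
\<close>

definition harvesting_model ::
    "'w measure \<Rightarrow> real \<Rightarrow> 'c set \<Rightarrow> real \<Rightarrow> real measure \<Rightarrow>
     ('w \<Rightarrow> ((real ^ 2) \<times> ('c \<Rightarrow> real)) config) \<Rightarrow>
     ('w \<Rightarrow> ((real ^ 2) \<times> real \<times> real) config) \<Rightarrow> bool" where
  "harvesting_model M lamBS CD lamUE Pw \<Phi>B \<Phi>U \<longleftrightarrow>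
     marked_ppp M lamBS (\<Pi>\<^sub>M c\<in>CD. fading_law) \<Phi>B \<and>
     marked_ppp M lamUE (Pw \<Otimes>\<^sub>M fading_law) \<Phi>U \<and>
     mutually_indep M
       [gen_sets M (config_space (borel \<Otimes>\<^sub>M (\<Pi>\<^sub>M c\<in>CD. fading_law))) \<Phi>B,
        gen_sets M (config_space (borel \<Otimes>\<^sub>M (Pw \<Otimes>\<^sub>M fading_law))) \<Phi>U]"

definition harvested_power ::
    "real \<Rightarrow> real \<Rightarrow> real \<Rightarrow> 'c set \<Rightarrow> ((real ^ 2) \<times> ('c \<Rightarrow> real)) config \<Rightarrow>
     ((real ^ 2) \<times> real \<times> real) config \<Rightarrow> ennreal" where
  "harvested_power a \<alpha> PB CD \<phi>B \<phi>U =
     ennreal a * point_sum (\<lambda>(x, h). \<Sum>c\<in>CD. ennreal (PB * h c * norm x powr (- \<alpha>))) \<phi>B +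
     ennreal a * point_sum (\<lambda>(u, P, h). ennreal (P * h * norm u powr (- \<alpha>))) \<phi>U"


section \<open>The SINR of a typical cellular user\<close>

definition sinr :: "ennreal \<Rightarrow> ennreal \<Rightarrow> ennreal" where
  "sinr s i = (if i = 0 then \<infinity> else s / i)"

definition d2d_interference ::
    "real \<Rightarrow> real \<Rightarrow> ((real ^ 2) \<times> real) config \<Rightarrow> ennreal" where
  "d2d_interference \<beta> PD = point_sum (\<lambda>(y, h). ennreal (PD * h * norm y powr (- \<beta>)))"

definition downlink_interference ::
    "real \<Rightarrow> real \<Rightarrow> real \<Rightarrow> ((real ^ 2) \<times> real) config \<Rightarrow> ennreal" where
  "downlink_interference \<alpha> PB r0 =
     point_sum (\<lambda>(x, h). if norm x > r0 then ennreal (PB * h * norm x powr (- \<alpha>)) else 0)"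

definition uplink_interference ::
    "real \<Rightarrow> real \<Rightarrow> ((real ^ 2) \<times> real \<times> real) config \<Rightarrow> ennreal" where
  "uplink_interference \<alpha> rhob =
     point_sum (\<lambda>(u, P, h). if norm u \<ge> (P / rhob) powr (1 / \<alpha>)
                            then ennreal (P * h * norm u powr (- \<alpha>)) else 0)"

text \<open>
  Conditionally on the serving distance \<open>r0\<close>, the downlink interferers are the points outside
  the disc of radius \<open>r0\<close> of a Poisson process: \<open>\<Phi>\<close> is taken on the whole plane and
  independent of \<open>r0\<close>, and \<open>downlink_interference\<close> performs the restriction.
\<close>

definition downlink_model ::
    "'w measure \<Rightarrow> real \<Rightarrow> real \<Rightarrow> real \<Rightarrow> ('w \<Rightarrow> real) \<Rightarrow> ('w \<Rightarrow> real) \<Rightarrow>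
     ('w \<Rightarrow> ((real ^ 2) \<times> real) config) \<Rightarrow> ('w \<Rightarrow> ((real ^ 2) \<times> real) config) \<Rightarrow> bool" where
  "downlink_model M lamB lamI lamT h r0 \<Phi> \<Psi> \<longleftrightarrow>
     prob_space M \<and>
     h \<in> borel_measurable M \<and> distr M borel h = fading_law \<and>
     r0 \<in> borel_measurable M \<and> distr M borel r0 = nearest_bs_law lamB \<and>
     marked_ppp M lamI fading_law \<Phi> \<and>
     marked_ppp M lamT fading_law \<Psi> \<and>
     mutually_indep M
       [gen_sets M borel h,
        gen_sets M borel r0,
        gen_sets M (config_space (borel \<Otimes>\<^sub>M fading_law)) \<Phi>,
        gen_sets M (config_space (borel \<Otimes>\<^sub>M fading_law)) \<Psi>]"

definition downlink_sinr ::
    "real \<Rightarrow> real \<Rightarrow> real \<Rightarrow> real \<Rightarrow> bool \<Rightarrow> real \<Rightarrow> real \<Rightarrow>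
     ((real ^ 2) \<times> real) config \<Rightarrow> ((real ^ 2) \<times> real) config \<Rightarrow> ennreal" where
  "downlink_sinr \<alpha> \<beta> PB PD shared h r0 \<phi> \<psi> =
     sinr (ennreal (PB * h * r0 powr (- \<alpha>)))
          (downlink_interference \<alpha> PB r0 \<phi> + (if shared then d2d_interference \<beta> PD \<psi> else 0))"

definition uplink_model ::
    "'w measure \<Rightarrow> real \<Rightarrow> real measure \<Rightarrow> real \<Rightarrow> ('w \<Rightarrow> real) \<Rightarrow>
     ('w \<Rightarrow> ((real ^ 2) \<times> real \<times> real) config) \<Rightarrow> ('w \<Rightarrow> ((real ^ 2) \<times> real) config) \<Rightarrow> bool" where
  "uplink_model M lamI Pw lamT h \<Phi> \<Psi> \<longleftrightarrow>
     prob_space M \<and>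
     h \<in> borel_measurable M \<and> distr M borel h = fading_law \<and>
     marked_ppp M lamI (Pw \<Otimes>\<^sub>M fading_law) \<Phi> \<and>
     marked_ppp M lamT fading_law \<Psi> \<and>
     mutually_indep M
       [gen_sets M borel h,
        gen_sets M (config_space (borel \<Otimes>\<^sub>M (Pw \<Otimes>\<^sub>M fading_law))) \<Phi>,
        gen_sets M (config_space (borel \<Otimes>\<^sub>M fading_law)) \<Psi>]"

definition uplink_sinr ::
    "real \<Rightarrow> real \<Rightarrow> real \<Rightarrow> real \<Rightarrow> bool \<Rightarrow> real \<Rightarrow>
     ((real ^ 2) \<times> real \<times> real) config \<Rightarrow> ((real ^ 2) \<times> real) config \<Rightarrow> ennreal" where
  "uplink_sinr \<alpha> \<beta> rhob PD shared h \<phi> \<psi> =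
     sinr (ennreal (rhob * h))
          (uplink_interference \<alpha> rhob \<phi> + (if shared then d2d_interference \<beta> PD \<psi> else 0))"

end

theory Submission
  imports Defs "HOL-Complex_Analysis.Complex_Analysis" "HOL-Real_Asymp.Real_Asymp"
begin

text \<open>
  The signal fading is exponential and independent of everything else, so the coverage probability
  is the expectation of \<open>exp (- s I)\<close> for the total interference \<open>I\<close>, where \<open>s\<close> depends
  only on the serving distance.  By the Laplace functional of a marked Poisson process, for a fixed
  serving distance this is the exponential of minus the intensity times the integral of
  \<open>A \<parallel>x\<parallel>\<^sup>-\<^sup>\<alpha> / (1 + A \<parallel>x\<parallel>\<^sup>-\<^sup>\<alpha>)\<close>: over the whole plane for the D2D transmitters, a Beta integral,
  and over the complement of a disc for the cellular transmitters, Euler's integral for the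
  hypergeometric function.  In the downlink both integrals are proportional to the squared serving
  distance, which is exponentially distributed; in the uplink the radius of the excluded disc is the
  distance of the interferer to its own base station, and only the second moment of this radius enters.
\<close>


section \<open>Laplace functionals of Poisson processes\<close>

text \<open>Interference is kept in the extended nonnegative reals, and \<open>expm\<close> extends
  exp (- x) by 0 at infinity. Thus no almost sure finiteness has to be proved, and limits pass
  through the transform. The Poisson process is given only by the law of its counts on sets of
  finite measure and by independence of counts on disjoint sets. The Laplace functional therefore
  has to be built up from step functions with support of finite measure. The hypergeometric function
  is specified by continuation, and its argument -\<tau> leaves the disc of convergence once \<tau>
  exceeds 1. Agreement of Euler's integral with the series is therefore not enough; the integral
  must also be holomorphic on the slit plane. Origin of the constants: the D2D integral over the
  plane scales like an area, as A^(2/\<beta>) with A the ratio of \<tau> times the D2D power to the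
  mean signal; this produces \<tau>^(2/\<beta>) and the square of \<open>d\<^sub>o\<close>, and the
  sine comes from the reflection formula. For the excluded disc the area scale is its squared
  radius, and the power \<tau>^(2/\<alpha>) in \<open>K2\<close> only compensates the scaling built
  into \<open>G_fun\<close>.\<close>

definition expm :: "ennreal \<Rightarrow> ennreal" where
  "expm x = (if x = \<infinity> then 0 else ennreal (exp (- enn2real x)))"

lemma expm_ennreal [simp]: "0 \<le> x \<Longrightarrow> expm (ennreal x) = ennreal (exp (- x))"
  by (simp add: expm_def)

lemma expm_0 [simp]: "expm 0 = 1"
  by (simp add: expm_def)

lemma expm_top [simp]: "expm top = 0"
  by (simp add: expm_def)

lemma expm_le_1 [simp]: "expm x \<le> 1"
  by (cases x) (auto simp flip: ennreal_1 intro!: ennreal_leI)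

lemma expm_neq_top [simp]: "expm x \<noteq> top"
  by (simp add: expm_def)

lemma expm_add: "expm (x + y) = expm x * expm y"
  by (cases x; cases y)
     (auto simp: mult_exp_exp top_add simp flip: ennreal_plus ennreal_mult)

lemma expm_sum: "finite I \<Longrightarrow> expm (\<Sum>i\<in>I. f i) = (\<Prod>i\<in>I. expm (f i))"
  by (induction I rule: finite_induct) (auto simp: expm_add)

lemma expm_antimono: "x \<le> y \<Longrightarrow> expm y \<le> expm x"
  by (cases x; cases y) (auto intro!: ennreal_leI simp: top_unique)

text \<open>The value 0 at infinity is the one that makes \<open>expm\<close> continuous there. This
  covers truncated series and monotone approximations whose limits may be infinite.\<close>

lemma tendsto_expm:
  assumes "(f \<longlongrightarrow> x) F"
  shows "((\<lambda>n. expm (f n)) \<longlongrightarrow> expm x) F"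
proof (cases x)
  case (real r)
  have "eventually (\<lambda>n. f n < top) F"
    using assms real by (auto intro: order_tendstoD)
  hence "eventually (\<lambda>n. ennreal (exp (- enn2real (f n))) = expm (f n)) F"
    by eventually_elim (auto simp: expm_def)
  moreover have "((\<lambda>n. ennreal (exp (- enn2real (f n)))) \<longlongrightarrow> ennreal (exp (- r))) F"
    using assms real by (intro tendsto_intros) auto
  ultimately show ?thesis
    using real by (auto intro: Lim_transform_eventually)
next
  case top
  show ?thesis unfolding top expm_top
  proof (rule order_tendstoI)
    fix a :: ennreal assume "0 < a"
    then obtain b where b: "0 < b" "ennreal b < a"
      by (metis dense ennreal_cases ennreal_less_zero_iff not_less_iff_gr_or_eq top.not_eq_extremum)
    define l where "l = max 0 (- ln b)"
    have "exp (- l) \<le> b"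
      unfolding l_def using b by (metis exp_le_cancel_iff exp_ln max.cobounded2 minus_le_iff)
    have "eventually (\<lambda>n. ennreal l < f n) F"
      using assms top unfolding top tendsto_top_iff_ennreal by (auto simp: l_def simp del: ennreal_max_0)
    thus "eventually (\<lambda>n. expm (f n) < a) F"
    proof eventually_elim
      case (elim n)
      have "expm (f n) \<le> expm (ennreal l)"
        using elim by (intro expm_antimono) auto
      also have "\<dots> = ennreal (exp (- l))" by (rule expm_ennreal) (simp add: l_def)
      also have "\<dots> \<le> ennreal b" using \<open>exp (- l) \<le> b\<close> by (rule ennreal_leI)
      finally show ?case using b by order
    qed
  qed auto
qed

lemma measurable_expm [measurable]: "expm \<in> borel_measurable borel"
  unfolding expm_def by measurable

text \<open>A right inverse of \<open>expm\<close> on [0, 1], infinite at 0. It turns infinite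
  products of expectations into series, which always converge in \<open>ennreal\<close>.\<close>

definition lnm :: "ennreal \<Rightarrow> ennreal" where
  "lnm y = (if y = 0 then \<infinity> else ennreal (- ln (enn2real y)))"

lemma measurable_lnm [measurable]: "lnm \<in> borel_measurable borel"
  unfolding lnm_def by measurable

lemma expm_lnm: "y \<le> 1 \<Longrightarrow> expm (lnm y) = y"
  unfolding lnm_def by (cases y) (auto simp: top_unique simp flip: ennreal_1)

section \<open>Sums over the points of a configuration\<close>

lemma space_config_space [simp]: "space (config_space S) = UNIV \<times> (UNIV \<rightarrow>\<^sub>E space S)"
  by (simp add: config_space_def space_pair_measure space_PiM)

lemma sets_config_space_cong: "sets S = sets T \<Longrightarrow> sets (config_space S) = sets (config_space T)"
  unfolding config_space_def by (intro sets_pair_measure_cong sets_PiM_cong) auto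

text \<open>The parameter \<open>p\<close> is needed for the downlink, whose summand depends on the
  random serving distance: joint measurability in the distance and the configuration is required
  there.\<close>

lemma measurable_point_sum:
  assumes f: "(\<lambda>(p, x). f p x) \<in> borel_measurable (K \<Otimes>\<^sub>M S)"
  shows "(\<lambda>(p, \<phi>). point_sum (f p) \<phi>) \<in> borel_measurable (K \<Otimes>\<^sub>M config_space S)"
proof -
  have 1: "(\<lambda>z. (fst z, snd (snd z) n)) \<in> K \<Otimes>\<^sub>M config_space S \<rightarrow>\<^sub>M K \<Otimes>\<^sub>M S" for n
    unfolding config_space_def by measurable
  have 2 [measurable]: "(\<lambda>z. f (fst z) (snd (snd z) n)) \<in> borel_measurable (K \<Otimes>\<^sub>M config_space S)" for n
    using measurable_compose[OF 1 f] by simp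
  have 3 [measurable]: "Measurable.pred (K \<Otimes>\<^sub>M config_space S) (\<lambda>z. enat n < fst (snd z))" for n
    unfolding config_space_def by measurable
  show ?thesis
    unfolding point_sum_def split_beta by (intro borel_measurable_suminf_order measurable_If 2) (use 3 in \<open>auto simp: pred_def\<close>)
qed

lemma measurable_point_sum':
  assumes f: "f \<in> borel_measurable S"
  shows "point_sum f \<in> borel_measurable (config_space S)"
proof -
  have "(\<lambda>\<phi>. ((), \<phi>)) \<in> config_space S \<rightarrow>\<^sub>M count_space UNIV \<Otimes>\<^sub>M config_space S"
    by measurable
  from measurable_compose[OF this measurable_point_sum[of "\<lambda>_. f"]] f show ?thesis
    by simp
qed

lemma point_sum_cmult: "point_sum (\<lambda>x. c * f x) \<phi> = c * point_sum f \<phi>"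
  unfolding point_sum_def ennreal_suminf_cmult[symmetric] by (intro suminf_cong) auto

lemma point_sum_sum:
  "finite I \<Longrightarrow> point_sum (\<lambda>x. \<Sum>i\<in>I. f i x) \<phi> = (\<Sum>i\<in>I. point_sum (f i) \<phi>)"
  unfolding point_sum_def by (subst suminf_sum[symmetric]) (auto intro!: suminf_cong)

lemma point_sum_SUP:
  assumes "incseq f"
  shows "point_sum (\<lambda>x. SUP k. f k x) \<phi> = (SUP k. point_sum (f k) \<phi>)"
proof -
  have "point_sum (\<lambda>x. SUP k. f k x) \<phi> = (\<Sum>n. SUP k. if enat n < fst \<phi> then f k (snd \<phi> n) else 0)"
    unfolding point_sum_def by (intro suminf_cong) auto
  also have "\<dots> = (SUP k. point_sum (f k) \<phi>)"
    unfolding point_sum_def using assms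
    by (intro ennreal_suminf_SUP_eq) (auto simp: incseq_def le_fun_def)
  finally show ?thesis .
qed

text \<open>This is the Laplace transform of a Poisson variable, obtained by summing the exponential
  series at \<open>l * exp (- a)\<close>.\<close>

lemma nn_integral_expm_poisson:
  assumes M: "prob_space M" and C: "C \<in> borel_measurable M" and "0 \<le> l" "0 \<le> a"
    and law: "\<And>k::nat. measure M {\<omega> \<in> space M. C \<omega> = of_nat k} = exp (- l) * l ^ k / fact k"
  shows "(\<integral>\<^sup>+\<omega>. expm (ennreal a * C \<omega>) \<partial>M) = expm (ennreal (l * (1 - exp (- a))))"
proof -
  interpret prob_space M by fact
  note C [measurable]
  define E where "E k = {\<omega> \<in> space M. C \<omega> = of_nat k}" for k :: nat
  have [measurable]: "E k \<in> events" for k unfolding E_def by measurable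
  have disj: "disjoint_family E" unfolding E_def disjoint_family_on_def by auto
  have sumE: "(\<lambda>k. exp (- l) * l ^ k / fact k) sums 1"
    using sums_mult[OF exp_converges[of l], of "exp (- l)"]
    by (simp add: exp_minus divide_inverse mult_ac)
  \<comment> \<open>The Poisson weights already add up to 1, so \<open>C\<close>, a priori any
    extended nonnegative real, is almost surely a natural number.\<close>
  have "measure M (\<Union>k. E k) = 1"
    using finite_measure_UNION[OF _ disj] sumE law sums_unique2 unfolding E_def by fastforce
  hence ae: "AE \<omega> in M. \<omega> \<in> (\<Union>k. E k)"
    by (subst (asm) prob_eq_1) auto
  have "(\<integral>\<^sup>+\<omega>. expm (ennreal a * C \<omega>) \<partial>M) =
        (\<integral>\<^sup>+\<omega>. (\<Sum>k. ennreal (exp (- a * real k)) * indicator (E k) \<omega>) \<partial>M)"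
  proof (intro nn_integral_cong_AE, use ae in eventually_elim)
    case (elim \<omega>)
    then obtain k where k: "\<omega> \<in> E k" by auto
    have "(\<lambda>j. ennreal (exp (- a * real j)) * indicator (E j) \<omega>) =
          (\<lambda>j. if j = k then ennreal (exp (- a * real k)) else 0)"
      using k unfolding E_def by (auto simp: fun_eq_iff split: split_indicator)
    hence "(\<Sum>j. ennreal (exp (- a * real j)) * indicator (E j) \<omega>) = ennreal (exp (- a * real k))"
      using sums_single[of k "\<lambda>_. ennreal (exp (- a * real k))"] by (simp add: sums_iff)
    moreover have "ennreal a * C \<omega> = ennreal (a * real k)"
      using k \<open>0 \<le> a\<close> unfolding E_def by (simp add: ennreal_mult ennreal_of_nat_eq_real_of_nat)
    ultimately show ?case using \<open>0 \<le> a\<close> by simp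
  qed
  also have "\<dots> = (\<Sum>k. ennreal (exp (- a * real k)) * emeasure M (E k))"
    by (subst nn_integral_suminf) (auto intro!: suminf_cong simp: nn_integral_cmult)
  also have "\<dots> = (\<Sum>k. ennreal (exp (- l) * ((l * exp (- a)) ^ k / fact k)))"
  proof (intro suminf_cong)
    fix k
    have "exp (- a * real k) = exp (- a) ^ k"
      by (metis exp_of_nat_mult mult.commute)
    thus "ennreal (exp (- a * real k)) * emeasure M (E k) = ennreal (exp (- l) * ((l * exp (- a)) ^ k / fact k))"
      unfolding emeasure_eq_measure using law[of k] assms(3)
      by (simp add: E_def power_mult_distrib mult_ac flip: ennreal_mult)
  qed
  also have "\<dots> = ennreal (exp (- l) * exp (l * exp (- a)))"
  proof (rule suminf_ennreal_eq)
    show "(\<lambda>k. exp (- l) * ((l * exp (- a)) ^ k / fact k)) sums (exp (- l) * exp (l * exp (- a)))"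
      using sums_mult[OF exp_converges[of "l * exp (- a)"], of "exp (- l)"]
      by (simp add: divide_inverse mult_ac)
  qed (use assms in auto)
  also have "\<dots> = expm (ennreal (l * (1 - exp (- a))))"
    using assms by (subst expm_ennreal) (auto simp: mult_exp_exp mult_left_le algebra_simps)
  finally show ?thesis .
qed

lemma point_sum_cong:
  assumes "\<phi> \<in> space (config_space S)" "\<And>x. x \<in> space S \<Longrightarrow> f x = g x"
  shows "point_sum f \<phi> = point_sum g \<phi>"
proof -
  have "snd \<phi> n \<in> space S" for n using assms(1) by (auto simp: mem_Times_iff)
  thus ?thesis unfolding point_sum_def by (intro suminf_cong) (auto simp: assms(2))
qed

text \<open>The sum over the points is a finite linear combination of the counts in the level sets
  of \<open>f\<close>. These counts are independent Poisson variables, so the transform factorizes,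
  and the exponents add up to an integral.\<close>

lemma laplace_poisson_simple:
  assumes pp: "poisson_process M \<Lambda> \<Phi>"
    and f: "simple_function \<Lambda> f" "\<And>x. f x < top"
    and fin: "emeasure \<Lambda> {x \<in> space \<Lambda>. f x \<noteq> 0} < \<infinity>"
  shows "(\<integral>\<^sup>+\<omega>. expm (point_sum f (\<Phi> \<omega>)) \<partial>M) = expm (\<integral>\<^sup>+x. 1 - expm (f x) \<partial>\<Lambda>)"
proof -
  interpret prob_space M using pp by (simp add: poisson_process_def)
  have \<Phi>: "\<Phi> \<in> M \<rightarrow>\<^sub>M config_space \<Lambda>" using pp by (simp add: poisson_process_def)
  have f_meas [measurable]: "f \<in> borel_measurable \<Lambda>" using f(1) by (rule borel_measurable_simple_function)
  define V where "V = f ` space \<Lambda> - {0}"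
  \<comment> \<open>The value 0 was left out of \<open>V\<close>: its level set may have infinite
    measure, and for such sets no law of the count is prescribed.\<close>
  have "finite V" using f(1) by (auto simp: V_def simple_function_def)
  then obtain v where v: "bij_betw v {..<card V} V"
    using ex_bij_betw_nat_finite[of V] by (auto simp: atLeast0LessThan)
  define m where "m = card V"
  define A where "A i = f -` {v i} \<inter> space \<Lambda>" for i
  define a where "a i = enn2real (v i)" for i
  have a: "ennreal (a i) = v i" "0 \<le> a i" if "i < m" for i
  proof -
    have "v i \<in> V" using v that by (auto simp: bij_betw_def m_def)
    hence "v i < top" using f(2) by (auto simp: V_def)
    thus "ennreal (a i) = v i" "0 \<le> a i" by (auto simp: a_def)
  qed
  have A [measurable]: "A i \<in> sets \<Lambda>" for i
    unfolding A_def using f(1) by (rule simple_functionD)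
  have A_fin: "emeasure \<Lambda> (A i) < \<infinity>" if "i < m" for i
  proof -
    have "v i \<noteq> 0" using v that by (auto simp: bij_betw_def m_def V_def)
    hence "A i \<subseteq> {x \<in> space \<Lambda>. f x \<noteq> 0}" by (auto simp: A_def)
    hence "emeasure \<Lambda> (A i) \<le> emeasure \<Lambda> {x \<in> space \<Lambda>. f x \<noteq> 0}" by (rule emeasure_mono) measurable
    thus ?thesis using fin by order
  qed
  have disj: "disjoint_family_on A {..<m}"
    using v by (auto simp: disjoint_family_on_def A_def m_def bij_betw_def inj_on_def)
  have at: "\<exists>i<m. x \<in> A i \<and> v i = f x \<and> (\<forall>j<m. x \<in> A j \<longleftrightarrow> j = i)" if "x \<in> space \<Lambda>" "f x \<noteq> 0" for x
  proof -
    from that have "f x \<in> V" by (auto simp: V_def)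
    then obtain i where i: "i < m" "v i = f x" using v by (force simp: bij_betw_def m_def)
    moreover have "x \<in> A j \<longleftrightarrow> j = i" if "j < m" for j
      using i that v \<open>x \<in> space \<Lambda>\<close> by (auto simp: A_def m_def bij_betw_def inj_on_def)
    ultimately show ?thesis using that by blast
  qed
  have notat: "x \<notin> A i" if "x \<in> space \<Lambda>" "f x = 0" "i < m" for x i
    using that v by (auto simp: A_def m_def bij_betw_def V_def)
  \<comment> \<open>Stated for arbitrary coefficients because the same level sets decompose both
    \<open>f\<close> and \<open>1 - expm (f x)\<close>, which vanish at the same points.\<close>
  have sum_at: "(\<Sum>i<m. g i * indicator (A i) x) = (if f x = 0 then 0 else g (THE i. i < m \<and> x \<in> A i))"
    if x: "x \<in> space \<Lambda>" for x and g :: "nat \<Rightarrow> ennreal"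
  proof (cases "f x = 0")
    case False
    from at[OF x False] obtain i where i: "i < m" "\<And>j. j < m \<Longrightarrow> x \<in> A j \<longleftrightarrow> j = i" by blast
    have "(\<Sum>j<m. g j * indicator (A j) x) = (\<Sum>j<m. if j = i then g i else 0)"
      using i by (intro sum.cong) (auto split: split_indicator)
    moreover have "(THE j. j < m \<and> x \<in> A j) = i" using i by (intro the_equality) auto
    ultimately show ?thesis using False i(1) by simp
  qed (use notat[OF x] in \<open>auto intro!: sum.neutral split: split_indicator\<close>)
  have the: "v (THE i. i < m \<and> x \<in> A i) = f x" "(THE i. i < m \<and> x \<in> A i) < m" 
    if x: "x \<in> space \<Lambda>" "f x \<noteq> 0" for x
  proof -
    from at[OF x] obtain i where i: "i < m" "v i = f x" "\<And>j. j < m \<Longrightarrow> x \<in> A j \<longleftrightarrow> j = i" by blast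
    have "(THE j. j < m \<and> x \<in> A j) = i" using i by (intro the_equality) auto
    thus "v (THE i. i < m \<and> x \<in> A i) = f x" "(THE i. i < m \<and> x \<in> A i) < m" using i by auto
  qed
  have f_eq: "f x = (\<Sum>i<m. ennreal (a i) * indicator (A i) x)" if "x \<in> space \<Lambda>" for x
    unfolding sum_at[OF that] using the[OF that] a by (cases "f x = 0") auto
  have e_eq: "1 - expm (f x) = (\<Sum>i<m. (1 - expm (ennreal (a i))) * indicator (A i) x)" if "x \<in> space \<Lambda>" for x
    unfolding sum_at[OF that] using the[OF that] a by (cases "f x = 0") auto
  have indep: "indep_vars (\<lambda>_. borel) (\<lambda>i \<omega>. count_in (A i) (\<Phi> \<omega>)) {..<m}"
    using pp A disj unfolding poisson_process_def by blast
  have count [measurable]: "(\<lambda>\<omega>. count_in (A i) (\<Phi> \<omega>)) \<in> borel_measurable M" for i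
    unfolding count_in_def using \<Phi> by (rule measurable_compose) (rule measurable_point_sum', measurable)
  have "(\<integral>\<^sup>+\<omega>. expm (point_sum f (\<Phi> \<omega>)) \<partial>M) =
        (\<integral>\<^sup>+\<omega>. (\<Prod>i<m. expm (ennreal (a i) * count_in (A i) (\<Phi> \<omega>))) \<partial>M)"
  proof (intro nn_integral_cong)
    fix \<omega> assume "\<omega> \<in> space M"
    hence "\<Phi> \<omega> \<in> space (config_space \<Lambda>)" using \<Phi> by (rule measurable_space[rotated])
    hence "point_sum f (\<Phi> \<omega>) = point_sum (\<lambda>x. \<Sum>i<m. ennreal (a i) * indicator (A i) x) (\<Phi> \<omega>)"
      by (rule point_sum_cong) (rule f_eq)
    also have "\<dots> = (\<Sum>i<m. ennreal (a i) * count_in (A i) (\<Phi> \<omega>))"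
      by (simp only: point_sum_sum point_sum_cmult count_in_def finite_lessThan)
    finally show "expm (point_sum f (\<Phi> \<omega>)) = (\<Prod>i<m. expm (ennreal (a i) * count_in (A i) (\<Phi> \<omega>)))"
      by (simp add: expm_sum)
  qed
  also have "\<dots> = (\<Prod>i<m. \<integral>\<^sup>+\<omega>. expm (ennreal (a i) * count_in (A i) (\<Phi> \<omega>)) \<partial>M)"
    by (intro indep_vars_nn_integral indep_vars_compose2[OF indep]) auto
  also have "\<dots> = (\<Prod>i<m. expm (ennreal (measure \<Lambda> (A i) * (1 - exp (- a i)))))"
  proof (intro prod.cong refl nn_integral_expm_poisson)
    fix i k :: nat assume "i \<in> {..<m}"
    thus "measure M {\<omega> \<in> space M. count_in (A i) (\<Phi> \<omega>) = of_nat k} =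
            exp (- measure \<Lambda> (A i)) * measure \<Lambda> (A i) ^ k / fact k"
      using pp A[of i] A_fin[of i] unfolding poisson_process_def by auto
  qed (use a prob_space_axioms in auto)
  also have "\<dots> = (\<Prod>i<m. expm ((1 - expm (ennreal (a i))) * emeasure \<Lambda> (A i)))"
  proof (intro prod.cong refl arg_cong[where f = expm])
    fix i assume "i \<in> {..<m}"
    hence i: "i < m" by simp
    have "1 - expm (ennreal (a i)) = ennreal (1 - exp (- a i))"
      using a(2)[OF i] by (simp add: ennreal_minus flip: ennreal_1)
    moreover have "emeasure \<Lambda> (A i) = ennreal (measure \<Lambda> (A i))"
      using A_fin[OF i] by (intro emeasure_eq_ennreal_measure) auto
    ultimately show "ennreal (measure \<Lambda> (A i) * (1 - exp (- a i))) = (1 - expm (ennreal (a i))) * emeasure \<Lambda> (A i)"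
      using a(2)[OF i] by (simp add: ennreal_mult mult.commute)
  qed
  also have "\<dots> = expm (\<integral>\<^sup>+x. (\<Sum>i<m. (1 - expm (ennreal (a i))) * indicator (A i) x) \<partial>\<Lambda>)"
    by (subst nn_integral_sum) (auto simp: expm_sum nn_integral_cmult)
  also have "(\<integral>\<^sup>+x. (\<Sum>i<m. (1 - expm (ennreal (a i))) * indicator (A i) x) \<partial>\<Lambda>) = (\<integral>\<^sup>+x. 1 - expm (f x) \<partial>\<Lambda>)"
    by (intro nn_integral_cong) (simp add: e_eq)
  finally show ?thesis .
qed

text \<open>Both sides of the identity for step functions are continuous along increasing
  approximations, the left by domination and the right by monotone convergence.\<close>

lemma laplace_poisson:
  assumes pp: "poisson_process M \<Lambda> \<Phi>" and "sigma_finite_measure \<Lambda>"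
    and f [measurable]: "f \<in> borel_measurable \<Lambda>"
  shows "(\<integral>\<^sup>+\<omega>. expm (point_sum f (\<Phi> \<omega>)) \<partial>M) = expm (\<integral>\<^sup>+x. 1 - expm (f x) \<partial>\<Lambda>)"
proof -
  interpret prob_space M using pp by (simp add: poisson_process_def)
  interpret \<Lambda>: sigma_finite_measure \<Lambda> by fact
  have \<Phi>: "\<Phi> \<in> M \<rightarrow>\<^sub>M config_space \<Lambda>" using pp by (simp add: poisson_process_def)
  obtain B where B: "range B \<subseteq> sets \<Lambda>" "(\<Union>i. B i) = space \<Lambda>" "\<And>i. emeasure \<Lambda> (B i) \<noteq> \<infinity>" "incseq B"
    using \<Lambda>.sigma_finite_incseq by blast
  have [measurable]: "B i \<in> sets \<Lambda>" for i using B(1) by auto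
  obtain F where F: "\<And>i. simple_function \<Lambda> (F i)" "incseq F" "\<And>i x. F i x < top" "\<And>x. (SUP i. F i x) = f x"
    using borel_measurable_implies_simple_function_sequence'[OF f] by metis
  \<comment> \<open>Simple approximations alone may have support of infinite measure. Cutting them
    off with the exhausting sets \<open>B i\<close> repairs this and keeps the sequence
    increasing.\<close>
  define G where "G i x = F i x * indicator (B i) x" for i x
  have G_simple: "simple_function \<Lambda> (G i)" for i
    unfolding G_def by (intro simple_function_mult F simple_function_indicator) measurable
  hence [measurable]: "G i \<in> borel_measurable \<Lambda>" for i by (rule borel_measurable_simple_function)
  have G_inc: "incseq G"
    unfolding incseq_def le_fun_def
  proof (intro allI impI)
    fix i j :: nat and x assume "i \<le> j"
    hence "F i x \<le> F j x" "B i \<subseteq> B j" using F(2) B(4) by (auto simp: incseq_def le_fun_def)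
    thus "G i x \<le> G j x" unfolding G_def by (auto split: split_indicator)
  qed
  have G_sup: "(\<lambda>i. G i x) \<longlonglongrightarrow> f x" if "x \<in> space \<Lambda>" for x
  proof -
    obtain i where "x \<in> B i" using B(2) \<open>x \<in> space \<Lambda>\<close> by auto
    hence "\<forall>j\<ge>i. G j x = F j x" using B(4) by (auto simp: G_def incseq_def split: split_indicator)
    hence "eventually (\<lambda>j. F j x = G j x) sequentially" unfolding eventually_sequentially by metis
    moreover have "(\<lambda>j. F j x) \<longlonglongrightarrow> f x"
      using LIMSEQ_SUP[of "\<lambda>j. F j x"] F(2,4) by (auto simp: incseq_def le_fun_def)
    ultimately show ?thesis by (rule Lim_transform_eventually[rotated])
  qed
  have G_sup': "f x = (SUP i. G i x)" if "x \<in> space \<Lambda>" for x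
    using G_sup[OF that] G_inc by (intro LIMSEQ_unique[OF _ LIMSEQ_SUP]) (auto simp: incseq_def le_fun_def)
  have eq: "(\<integral>\<^sup>+\<omega>. expm (point_sum (G i) (\<Phi> \<omega>)) \<partial>M) = expm (\<integral>\<^sup>+x. 1 - expm (G i x) \<partial>\<Lambda>)" for i
  proof (rule laplace_poisson_simple[OF pp G_simple])
    show "G i x < top" for x unfolding G_def using F(3)[of i x] by (auto split: split_indicator)
    have "emeasure \<Lambda> {x \<in> space \<Lambda>. G i x \<noteq> 0} \<le> emeasure \<Lambda> (B i)"
      by (intro emeasure_mono) (auto simp: G_def split: split_indicator_asm)
    thus "emeasure \<Lambda> {x \<in> space \<Lambda>. G i x \<noteq> 0} < \<infinity>" using B(3)[of i] by (simp add: less_top le_less_trans)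
  qed
  \<comment> \<open>These integrands decrease in \<open>i\<close>, so the constant 1, integrable
    over a probability space, serves as a dominating function.\<close>
  have "(\<lambda>i. \<integral>\<^sup>+\<omega>. expm (point_sum (G i) (\<Phi> \<omega>)) \<partial>M) \<longlonglongrightarrow> (\<integral>\<^sup>+\<omega>. expm (point_sum f (\<Phi> \<omega>)) \<partial>M)"
  proof (rule nn_integral_dominated_convergence[where w = "\<lambda>_. 1"])
    show "(\<lambda>\<omega>. expm (point_sum (G i) (\<Phi> \<omega>))) \<in> borel_measurable M" for i
      by (intro measurable_compose[OF measurable_compose[OF \<Phi> measurable_point_sum'] measurable_expm]) measurable
    show "(\<lambda>\<omega>. expm (point_sum f (\<Phi> \<omega>))) \<in> borel_measurable M"
      by (intro measurable_compose[OF measurable_compose[OF \<Phi> measurable_point_sum'] measurable_expm]) measurable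
    show "AE \<omega> in M. (\<lambda>i. expm (point_sum (G i) (\<Phi> \<omega>))) \<longlonglongrightarrow> expm (point_sum f (\<Phi> \<omega>))"
    proof (intro AE_I2 tendsto_expm)
      fix \<omega> assume "\<omega> \<in> space M"
      hence "\<Phi> \<omega> \<in> space (config_space \<Lambda>)" using \<Phi> by (rule measurable_space[rotated])
      hence "point_sum f (\<Phi> \<omega>) = point_sum (\<lambda>x. SUP i. G i x) (\<Phi> \<omega>)"
        by (rule point_sum_cong) (rule G_sup')
      also have "\<dots> = (SUP i. point_sum (G i) (\<Phi> \<omega>))" by (rule point_sum_SUP[OF G_inc])
      finally show "(\<lambda>i. point_sum (G i) (\<Phi> \<omega>)) \<longlonglongrightarrow> point_sum f (\<Phi> \<omega>)"
        using G_inc by (auto intro!: LIMSEQ_SUP suminf_le simp: incseq_def le_fun_def point_sum_def)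
    qed
  qed (auto simp: emeasure_space_1)
  \<comment> \<open>The convergence is needed at every point of the type. Outside the space all
    \<open>G i\<close> vanish whatever \<open>f\<close> is there, which explains the limit 0 in that
    branch.\<close>
  moreover have "(\<lambda>i. expm (\<integral>\<^sup>+x. 1 - expm (G i x) \<partial>\<Lambda>)) \<longlonglongrightarrow> expm (\<integral>\<^sup>+x. (if x \<in> space \<Lambda> then 1 - expm (f x) else 0) \<partial>\<Lambda>)"
  proof (rule tendsto_expm, rule nn_integral_LIMSEQ)
    show "incseq (\<lambda>i x. 1 - expm (G i x))"
      using G_inc by (auto simp: incseq_def le_fun_def intro!: ennreal_minus_mono expm_antimono)
    have "G i x = 0" if "x \<notin> space \<Lambda>" for i x
      using B(2) that by (auto simp: G_def)
    moreover have "(\<lambda>i. 1 - expm (G i x)) \<longlonglongrightarrow> 1 - expm (f x)" if "x \<in> space \<Lambda>" for x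
      by (intro tendsto_diff_ennreal tendsto_expm G_sup that tendsto_const) auto
    ultimately show "(\<lambda>i. 1 - expm (G i x)) \<longlonglongrightarrow> (if x \<in> space \<Lambda> then 1 - expm (f x) else 0)" for x
      by auto
  qed measurable
  moreover have "(\<integral>\<^sup>+x. (if x \<in> space \<Lambda> then 1 - expm (f x) else 0) \<partial>\<Lambda>) = (\<integral>\<^sup>+x. 1 - expm (f x) \<partial>\<Lambda>)"
    by (intro nn_integral_cong) auto
  ultimately show ?thesis unfolding eq by (metis LIMSEQ_unique)
qed

section \<open>Independence and marks\<close>

lemma gen_sets_Int_stable: "Int_stable (gen_sets M N X)"
proof (rule Int_stableI)
  fix a b assume "a \<in> gen_sets M N X" "b \<in> gen_sets M N X"
  then obtain A B where "A \<in> sets N" "B \<in> sets N" "a = X -` A \<inter> space M" "b = X -` B \<inter> space M"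
    by (auto simp: gen_sets_def)
  thus "a \<inter> b \<in> gen_sets M N X"
    unfolding gen_sets_def by (auto intro!: exI[of _ "A \<inter> B"])
qed

text \<open>Used to peel off first the signal fading and then the serving distance, leaving the two
  interfering processes.\<close>

lemma mutually_indep_tl: 
  assumes "prob_space M" "mutually_indep M (F # Fs)" 
  shows "mutually_indep M Fs"
proof -
  interpret prob_space M by fact
  have F: "indep_sets (\<lambda>i. (F # Fs) ! i) {..<Suc (length Fs)}"
    using assms by (simp add: mutually_indep_def)
  show ?thesis unfolding mutually_indep_def
  proof (rule indep_setsI)
    fix i assume "i \<in> {..<length Fs}"
    thus "Fs ! i \<subseteq> events" using F unfolding indep_sets_def by force
  next
    fix A J assume J: "J \<noteq> {}" "J \<subseteq> {..<length Fs}" "finite J" "\<forall>j\<in>J. A j \<in> Fs ! j"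
    have "prob (\<Inter>j\<in>Suc ` J. A (j - 1)) = (\<Prod>j\<in>Suc ` J. prob (A (j - 1)))"
      using J by (intro indep_setsD[OF F]) auto
    thus "prob (\<Inter>j\<in>J. A j) = (\<Prod>j\<in>J. prob (A j))"
      by (simp add: prod.reindex)
  qed
qed

text \<open>\<open>Y\<close> only has to be measurable for the sigma-algebra generated by all
  remaining families, so it may be a tuple of several of the independent variables. Stability of the
  families under intersection lets independence pass to the generated sigma-algebras.\<close>

lemma distr_pair_indep:
  assumes M: "prob_space M" and indep: "mutually_indep M (gen_sets M N1 X # Fs)"
    and X [measurable]: "X \<in> M \<rightarrow>\<^sub>M N1" and Y: "Y \<in> M \<rightarrow>\<^sub>M N2"
    and Y_gen: "Y \<in> sigma (space M) (\<Union>(set Fs)) \<rightarrow>\<^sub>M N2"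
    and stable: "\<forall>F\<in>set Fs. Int_stable F"
  shows "distr M (N1 \<Otimes>\<^sub>M N2) (\<lambda>\<omega>. (X \<omega>, Y \<omega>)) = distr M N1 X \<Otimes>\<^sub>M distr M N2 Y"
proof -
  interpret prob_space M by fact
  note Y [measurable]
  define F where "F = gen_sets M N1 X # Fs"
  \<comment> \<open>Two blocks of indices: \<open>True\<close> stands for the head family of
    \<open>X\<close>, \<open>False\<close> for all the others.\<close>
  define I :: "bool \<Rightarrow> nat set" where "I b = (if b then {0} else {1..length Fs})" for b
  have I_un: "(\<Union>b\<in>UNIV. I b) = {..<length F}"
    by (auto simp: I_def F_def UNIV_bool)
  have F: "indep_sets (\<lambda>i. F ! i) (\<Union>b\<in>UNIV. I b)"
    unfolding I_un using indep by (simp add: mutually_indep_def F_def)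
  have ind: "indep_sets (\<lambda>b. sigma_sets (space M) (\<Union>i\<in>I b. F ! i)) UNIV"
  proof (rule indep_sets_collect_sigma[OF F])
    show "Int_stable (F ! i)" if "i \<in> I b" for i b
      using that stable by (cases i) (auto simp: I_def F_def gen_sets_Int_stable split: if_splits)
  qed (auto simp: disjoint_family_on_def I_def)
  have Fs_ev: "\<Union>(set Fs) \<subseteq> Pow (space M)"
  proof -
    have "G \<subseteq> events" if G: "G \<in> set Fs" for G
    proof -
      obtain i where "i < length Fs" "G = Fs ! i" using G by (auto simp: in_set_conv_nth)
      thus ?thesis using F unfolding indep_sets_def I_un by (auto simp: F_def dest!: bspec[of _ _ "Suc i"])
    qed
    thus ?thesis using sets.sets_into_space by blast
  qed
  have Fs_I: "(\<Union>i\<in>I False. F ! i) = \<Union>(set Fs)"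
  proof -
    have "I False = Suc ` {..<length Fs}"
      by (auto simp: I_def image_Suc_lessThan)
    hence "(\<Union>i\<in>I False. F ! i) = (\<Union>i<length Fs. Fs ! i)"
      by (simp add: F_def)
    also have "\<dots> = \<Union>(set Fs)"
      by (rule arg_cong[where f = Union]) (auto simp: set_conv_nth)
    finally show ?thesis .
  qed
  have "distr M N1 X \<Otimes>\<^sub>M distr M N2 Y = distr M (N1 \<Otimes>\<^sub>M N2) (\<lambda>\<omega>. (X \<omega>, Y \<omega>))"
  proof (rule pair_measure_eqI)
    show "sigma_finite_measure (distr M N1 X)" "sigma_finite_measure (distr M N2 Y)"
      by (auto intro!: prob_space_imp_sigma_finite prob_space_distr X Y)
    fix A B assume "A \<in> sets (distr M N1 X)" "B \<in> sets (distr M N2 Y)"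
    hence [measurable]: "A \<in> sets N1" "B \<in> sets N2" by auto
    have B: "Y -` B \<inter> space M \<in> sigma_sets (space M) (\<Union>(set Fs))"
      using measurable_sets[OF Y_gen \<open>B \<in> sets N2\<close>] Fs_ev by (simp add: space_measure_of_conv)
    have A: "X -` A \<inter> space M \<in> sigma_sets (space M) (\<Union>i\<in>I True. F ! i)"
      unfolding I_def F_def by (auto intro!: sigma_sets.Basic simp: gen_sets_def)
    define E where "E b = (if b then X -` A \<inter> space M else Y -` B \<inter> space M)" for b
    have "prob (\<Inter>b\<in>UNIV. E b) = (\<Prod>b\<in>UNIV. prob (E b))"
      using A B by (intro indep_setsD[OF ind]) (auto simp: E_def Fs_I)
    hence "prob ((X -` A \<inter> space M) \<inter> (Y -` B \<inter> space M)) = prob (X -` A \<inter> space M) * prob (Y -` B \<inter> space M)"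
      by (simp add: UNIV_bool E_def mult.commute Int_commute)
    moreover have "(\<lambda>\<omega>. (X \<omega>, Y \<omega>)) -` (A \<times> B) \<inter> space M = (X -` A \<inter> space M) \<inter> (Y -` B \<inter> space M)"
      by auto
    ultimately show "emeasure (distr M N1 X) A * emeasure (distr M N2 Y) B =
        emeasure (distr M (N1 \<Otimes>\<^sub>M N2) (\<lambda>\<omega>. (X \<omega>, Y \<omega>))) (A \<times> B)"
      by (simp add: emeasure_distr emeasure_eq_measure ennreal_mult)
  qed (simp)
  thus ?thesis ..
qed

lemma measurable_gen_sets:
  assumes "X \<in> M \<rightarrow>\<^sub>M N" "gen_sets M N X \<in> set Fs" "\<Union>(set Fs) \<subseteq> Pow (space M)"
  shows "X \<in> sigma (space M) (\<Union>(set Fs)) \<rightarrow>\<^sub>M N"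
proof (rule measurableI)
  fix A assume "A \<in> sets N"
  hence "X -` A \<inter> space M \<in> \<Union>(set Fs)"
    using assms(2) by (intro UnionI[of "gen_sets M N X"]) (auto simp: gen_sets_def)
  thus "X -` A \<inter> space (sigma (space M) (\<Union>(set Fs))) \<in> sets (sigma (space M) (\<Union>(set Fs)))"
    using assms(3) by (auto simp: space_measure_of_conv intro!: sigma_sets.Basic)
qed (use assms in \<open>auto simp: space_measure_of_conv dest: measurable_space\<close>)

lemma gen_sets_subset_Pow: "gen_sets M N X \<subseteq> Pow (space M)"
  by (auto simp: gen_sets_def)

text \<open>Both orders are used: (1) freezes \<open>X\<close>, for conditioning on the locations or
  on the serving distance; (2) freezes \<open>Y\<close>, so that the signal fading is integrated out
  first.\<close>

lemma nn_integral_pair_indep: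
  assumes M: "prob_space M" and indep: "mutually_indep M (gen_sets M N1 X # Fs)"
    and X [measurable]: "X \<in> M \<rightarrow>\<^sub>M N1" and Y [measurable]: "Y \<in> M \<rightarrow>\<^sub>M N2"
    and Y_gen: "Y \<in> sigma (space M) (\<Union>(set Fs)) \<rightarrow>\<^sub>M N2"
    and stable: "\<forall>F\<in>set Fs. Int_stable F"
    and f [measurable]: "(\<lambda>(x, y). f x y) \<in> borel_measurable (N1 \<Otimes>\<^sub>M N2)"
  shows "(\<integral>\<^sup>+\<omega>. f (X \<omega>) (Y \<omega>) \<partial>M) = (\<integral>\<^sup>+\<omega>. \<integral>\<^sup>+\<omega>'. f (X \<omega>) (Y \<omega>') \<partial>M \<partial>M)"
    and "(\<integral>\<^sup>+\<omega>. f (X \<omega>) (Y \<omega>) \<partial>M) = (\<integral>\<^sup>+\<omega>'. \<integral>\<^sup>+\<omega>. f (X \<omega>) (Y \<omega>') \<partial>M \<partial>M)"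
proof -
  interpret prob_space M by fact
  interpret X: prob_space "distr M N1 X" by (rule prob_space_distr) fact
  interpret Y: prob_space "distr M N2 Y" by (rule prob_space_distr) fact
  interpret XY: pair_sigma_finite "distr M N1 X" "distr M N2 Y" ..
  have "(\<integral>\<^sup>+\<omega>. f (X \<omega>) (Y \<omega>) \<partial>M) = (\<integral>\<^sup>+z. f (fst z) (snd z) \<partial>distr M (N1 \<Otimes>\<^sub>M N2) (\<lambda>\<omega>. (X \<omega>, Y \<omega>)))"
    using f by (subst nn_integral_distr) (auto simp: split_beta)
  also have "\<dots> = (\<integral>\<^sup>+z. f (fst z) (snd z) \<partial>(distr M N1 X \<Otimes>\<^sub>M distr M N2 Y))"
    by (subst distr_pair_indep[OF M indep X Y Y_gen stable]) simp
  finally have *: "(\<integral>\<^sup>+\<omega>. f (X \<omega>) (Y \<omega>) \<partial>M) = \<dots>" .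
  have [measurable]: "(\<lambda>z. f (fst z) (snd z)) \<in> borel_measurable (distr M N1 X \<Otimes>\<^sub>M distr M N2 Y)"
    using f by (simp add: split_beta cong: measurable_cong_sets)
  have [measurable]: "(\<lambda>x. f x y) \<in> borel_measurable N1" if "y \<in> space N2" for y
    using measurable_compose[OF measurable_Pair1' f] that by simp
  have [measurable]: "(\<lambda>y. f x y) \<in> borel_measurable N2" if "x \<in> space N1" for x
    using measurable_compose[OF measurable_Pair1' f] that by simp
  have 1: "(\<lambda>x. \<integral>\<^sup>+\<omega>. f x (Y \<omega>) \<partial>M) \<in> borel_measurable N1"
    by measurable
  have 2: "(\<lambda>y. \<integral>\<^sup>+\<omega>. f (X \<omega>) y \<partial>M) \<in> borel_measurable N2"
    by measurable
  have "(\<integral>\<^sup>+z. f (fst z) (snd z) \<partial>(distr M N1 X \<Otimes>\<^sub>M distr M N2 Y)) = (\<integral>\<^sup>+x. \<integral>\<^sup>+y. f x y \<partial>distr M N2 Y \<partial>distr M N1 X)"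
    by (subst Y.nn_integral_fst[symmetric]) auto
  also have "\<dots> = (\<integral>\<^sup>+x. \<integral>\<^sup>+\<omega>. f x (Y \<omega>) \<partial>M \<partial>distr M N1 X)"
    by (intro nn_integral_cong nn_integral_distr) auto
  also have "\<dots> = (\<integral>\<^sup>+\<omega>. \<integral>\<^sup>+\<omega>'. f (X \<omega>) (Y \<omega>') \<partial>M \<partial>M)"
    using 1 by (subst nn_integral_distr) auto
  finally show "(\<integral>\<^sup>+\<omega>. f (X \<omega>) (Y \<omega>) \<partial>M) = (\<integral>\<^sup>+\<omega>. \<integral>\<^sup>+\<omega>'. f (X \<omega>) (Y \<omega>') \<partial>M \<partial>M)" using * by simp
  have "(\<integral>\<^sup>+z. f (fst z) (snd z) \<partial>(distr M N1 X \<Otimes>\<^sub>M distr M N2 Y)) = (\<integral>\<^sup>+y. \<integral>\<^sup>+x. f x y \<partial>distr M N1 X \<partial>distr M N2 Y)"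
    by (subst XY.nn_integral_snd[symmetric]) auto
  also have "\<dots> = (\<integral>\<^sup>+y. \<integral>\<^sup>+\<omega>. f (X \<omega>) y \<partial>M \<partial>distr M N2 Y)"
    by (intro nn_integral_cong nn_integral_distr) auto
  also have "\<dots> = (\<integral>\<^sup>+\<omega>'. \<integral>\<^sup>+\<omega>. f (X \<omega>) (Y \<omega>') \<partial>M \<partial>M)"
    using 2 by (subst nn_integral_distr) auto
  finally show "(\<integral>\<^sup>+\<omega>. f (X \<omega>) (Y \<omega>) \<partial>M) = (\<integral>\<^sup>+\<omega>'. \<integral>\<^sup>+\<omega>. f (X \<omega>) (Y \<omega>') \<partial>M \<partial>M)" using * by simp
qed

text \<open>Independence gives the product formula for finitely many terms, and domination by 1
  gives the limit. The functions \<open>F n\<close> vary with \<open>n\<close> because the marks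
  will be seen at different, frozen locations.\<close>

lemma nn_integral_expm_iid:
  assumes M: "prob_space M" and X: "iid M Q X" and F [measurable]: "\<And>n. F n \<in> borel_measurable Q"
  shows "(\<integral>\<^sup>+\<omega>. expm (\<Sum>n. F n (X n \<omega>)) \<partial>M) = expm (\<Sum>n. lnm (\<integral>\<^sup>+m. expm (F n m) \<partial>Q))"
proof -
  interpret prob_space M by fact
  have indep: "indep_vars (\<lambda>_. Q) X UNIV" and distr: "distr M Q (X n) = Q" for n
    using X by (auto simp: iid_def)
  have [measurable]: "X n \<in> M \<rightarrow>\<^sub>M Q" for n using indep by (auto simp: indep_vars_def)
  interpret Q: prob_space Q
    using prob_space_distr[of "X 0" Q] distr[of 0] by simp
  have le1: "(\<integral>\<^sup>+m. expm (F n m) \<partial>Q) \<le> 1" for n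
    using nn_integral_mono[of Q "\<lambda>m. expm (F n m)" "\<lambda>_. 1"] by (simp add: Q.emeasure_space_1)
  have "(\<integral>\<^sup>+\<omega>. expm (\<Sum>n<k. F n (X n \<omega>)) \<partial>M) = expm (\<Sum>n<k. lnm (\<integral>\<^sup>+m. expm (F n m) \<partial>Q))" for k
  proof -
    have "(\<integral>\<^sup>+\<omega>. expm (\<Sum>n<k. F n (X n \<omega>)) \<partial>M) = (\<integral>\<^sup>+\<omega>. (\<Prod>n<k. expm (F n (X n \<omega>))) \<partial>M)"
      by (simp add: expm_sum)
    also have "\<dots> = (\<Prod>n<k. \<integral>\<^sup>+\<omega>. expm (F n (X n \<omega>)) \<partial>M)"
      by (intro indep_vars_nn_integral indep_vars_compose2[OF indep_vars_subset[OF indep]]) auto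
    also have "\<dots> = (\<Prod>n<k. \<integral>\<^sup>+m. expm (F n m) \<partial>Q)"
    proof (intro prod.cong refl)
      fix n
      have "(\<integral>\<^sup>+m. expm (F n m) \<partial>distr M Q (X n)) = (\<integral>\<^sup>+\<omega>. expm (F n (X n \<omega>)) \<partial>M)"
        by (rule nn_integral_distr) measurable
      thus "(\<integral>\<^sup>+\<omega>. expm (F n (X n \<omega>)) \<partial>M) = (\<integral>\<^sup>+m. expm (F n m) \<partial>Q)" by (simp add: distr)
    qed
    also have "\<dots> = expm (\<Sum>n<k. lnm (\<integral>\<^sup>+m. expm (F n m) \<partial>Q))"
      by (simp add: expm_sum expm_lnm le1)
    finally show ?thesis .
  qed
  moreover have "(\<lambda>k. \<integral>\<^sup>+\<omega>. expm (\<Sum>n<k. F n (X n \<omega>)) \<partial>M) \<longlonglongrightarrow> (\<integral>\<^sup>+\<omega>. expm (\<Sum>n. F n (X n \<omega>)) \<partial>M)"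
    by (rule nn_integral_dominated_convergence[where w = "\<lambda>_. 1"])
       (auto intro!: tendsto_expm summable_LIMSEQ simp: emeasure_space_1)
  moreover have "(\<lambda>k. expm (\<Sum>n<k. lnm (\<integral>\<^sup>+m. expm (F n m) \<partial>Q))) \<longlonglongrightarrow> expm (\<Sum>n. lnm (\<integral>\<^sup>+m. expm (F n m) \<partial>Q))"
    by (intro tendsto_expm summable_LIMSEQ) auto
  ultimately show ?thesis by (simp add: LIMSEQ_unique)
qed

lemma sigma_finite_scale_measure:
  assumes "sigma_finite_measure M" "r < top"
  shows "sigma_finite_measure (scale_measure r M)"
proof -
  obtain A where "countable A" "A \<subseteq> sets M" "\<Union>A = space M" "\<forall>a\<in>A. emeasure M a \<noteq> \<infinity>"
    using sigma_finite_measure.sigma_finite_countable[OF assms(1)] by auto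
  thus ?thesis using assms(2)
    by (intro sigma_finite_measure.intro exI[of _ A])
       (auto simp: space_scale_measure ennreal_mult_eq_top_iff)
qed

text \<open>
  Integrating out the marks first turns \<open>f x m\<close> into \<open>f' x = - ln E exp (- f x m)\<close> and so
  reduces the claim to the process of locations.
\<close>

lemma laplace_marked_ppp:
  assumes ppp: "marked_ppp M lam Q \<Phi>"
    and f [measurable]: "(\<lambda>(x, m). f x m) \<in> borel_measurable (borel \<Otimes>\<^sub>M Q)"
  shows "(\<integral>\<^sup>+\<omega>. expm (point_sum (\<lambda>(x, m). f x m) (\<Phi> \<omega>)) \<partial>M) =
         expm (ennreal lam * (\<integral>\<^sup>+x. \<integral>\<^sup>+m. 1 - expm (f x m) \<partial>Q \<partial>lborel))"
proof -
  define \<Lambda> :: "(real ^ 2) measure" where "\<Lambda> = scale_measure (ennreal lam) lborel"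
  define L where "L \<omega> = locations (\<Phi> \<omega>)" for \<omega>
  define K where "K \<omega> = marks (\<Phi> \<omega>)" for \<omega>
  have pp: "poisson_process M \<Lambda> L" and iid: "iid M Q (\<lambda>n \<omega>. K \<omega> n)"
    and indep: "mutually_indep M [gen_sets M (config_space borel) L, gen_sets M (\<Pi>\<^sub>M n\<in>UNIV. Q) K]"
    using ppp unfolding marked_ppp_def \<Lambda>_def L_def K_def by auto
  interpret prob_space M using pp by (simp add: poisson_process_def)
  have K: "K \<in> M \<rightarrow>\<^sub>M (\<Pi>\<^sub>M n\<in>UNIV. Q)"
  proof (rule measurable_PiM_single')
    show "(\<lambda>\<omega>. K \<omega> n) \<in> M \<rightarrow>\<^sub>M Q" for n
      using iid by (auto simp: iid_def indep_vars_def)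
    thus "K \<in> space M \<rightarrow> UNIV \<rightarrow>\<^sub>E space Q" by (auto dest: measurable_space)
  qed
  have sets_\<Lambda>: "sets (config_space \<Lambda>) = sets (config_space borel)"
    by (rule sets_config_space_cong) (simp add: \<Lambda>_def)
  have L: "L \<in> M \<rightarrow>\<^sub>M config_space borel"
    using pp measurable_cong_sets[OF refl sets_\<Lambda>, of M] by (auto simp: poisson_process_def)
  interpret Q: prob_space Q
  proof -
    have "(\<lambda>\<omega>. K \<omega> 0) \<in> M \<rightarrow>\<^sub>M Q" "distr M Q (\<lambda>\<omega>. K \<omega> 0) = Q"
      using iid by (auto simp: iid_def indep_vars_def)
    thus "prob_space Q" using prob_space_distr[of "\<lambda>\<omega>. K \<omega> 0" Q] by simp
  qed
  \<comment> \<open>The locations and the marks are separated into two arguments, so that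
    independence can be applied to the pair.\<close>
  define S where "S \<phi> \<kappa> = (\<Sum>n. if enat n < fst \<phi> then f (snd \<phi> n) (\<kappa> n) else 0)"
    for \<phi> :: "(real ^ 2) config" and \<kappa>
  define f' where "f' x = lnm (\<integral>\<^sup>+m. expm (f x m) \<partial>Q)" for x
  have fx [measurable]: "f x \<in> borel_measurable Q" for x
    using measurable_compose[OF measurable_Pair1' f] by simp
  have f' [measurable]: "f' \<in> borel_measurable borel" unfolding f'_def by measurable
  have S_meas: "(\<lambda>(\<phi>, \<kappa>). expm (S \<phi> \<kappa>)) \<in> borel_measurable (config_space borel \<Otimes>\<^sub>M (\<Pi>\<^sub>M n\<in>UNIV. Q))"
  proof -
    have "(\<lambda>z. (snd (fst z) n, snd z n)) \<in> config_space borel \<Otimes>\<^sub>M (\<Pi>\<^sub>M n\<in>UNIV. Q) \<rightarrow>\<^sub>M borel \<Otimes>\<^sub>M Q" for n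
      unfolding config_space_def by measurable
    from measurable_compose[OF this f]
    have 1: "(\<lambda>z. f (snd (fst z) n) (snd z n)) \<in> borel_measurable (config_space borel \<Otimes>\<^sub>M (\<Pi>\<^sub>M n\<in>UNIV. Q))" for n
      by simp
    have 2: "Measurable.pred (config_space borel \<Otimes>\<^sub>M (\<Pi>\<^sub>M n\<in>UNIV. Q)) (\<lambda>z. enat n < fst (fst z))" for n
      unfolding config_space_def by measurable
    show ?thesis unfolding S_def split_beta
      by (intro measurable_compose[OF borel_measurable_suminf_order measurable_expm] measurable_If 1)
         (use 2 in \<open>auto simp: pred_def\<close>)
  qed
  have "(\<integral>\<^sup>+\<omega>. expm (point_sum (\<lambda>(x, m). f x m) (\<Phi> \<omega>)) \<partial>M) = (\<integral>\<^sup>+\<omega>. expm (S (L \<omega>) (K \<omega>)) \<partial>M)"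
    by (simp add: S_def point_sum_def L_def K_def locations_def marks_def split_beta cong: if_cong)
  also have "\<dots> = (\<integral>\<^sup>+\<omega>. \<integral>\<^sup>+\<omega>'. expm (S (L \<omega>) (K \<omega>')) \<partial>M \<partial>M)"
  proof (rule nn_integral_pair_indep(1)[OF prob_space_axioms indep L K _ _ S_meas])
    show "K \<in> sigma (space M) (\<Union>(set [gen_sets M (\<Pi>\<^sub>M n\<in>UNIV. Q) K])) \<rightarrow>\<^sub>M (\<Pi>\<^sub>M n\<in>UNIV. Q)"
      by (intro measurable_gen_sets K) (simp_all add: gen_sets_subset_Pow)
  qed (simp add: gen_sets_Int_stable)
  also have "\<dots> = (\<integral>\<^sup>+\<omega>. expm (point_sum f' (L \<omega>)) \<partial>M)"
  proof (intro nn_integral_cong)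
    fix \<omega>
    have "(\<integral>\<^sup>+\<omega>'. expm (S (L \<omega>) (K \<omega>')) \<partial>M) =
          expm (\<Sum>n. lnm (\<integral>\<^sup>+m. expm (if enat n < fst (L \<omega>) then f (snd (L \<omega>) n) m else 0) \<partial>Q))"
      unfolding S_def by (rule nn_integral_expm_iid[OF prob_space_axioms iid]) simp
    \<comment> \<open>Indices at or beyond the number of points contribute \<open>lnm 1 = 0\<close>,
      so the series is again a sum over the points.\<close>
    also have "(\<lambda>n. lnm (\<integral>\<^sup>+m. expm (if enat n < fst (L \<omega>) then f (snd (L \<omega>) n) m else 0) \<partial>Q)) =
               (\<lambda>n. if enat n < fst (L \<omega>) then f' (snd (L \<omega>) n) else 0)"
      by (auto simp: fun_eq_iff f'_def lnm_def Q.emeasure_space_1)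
    finally show "(\<integral>\<^sup>+\<omega>'. expm (S (L \<omega>) (K \<omega>')) \<partial>M) = expm (point_sum f' (L \<omega>))"
      by (simp add: point_sum_def)
  qed
  also have "\<dots> = expm (\<integral>\<^sup>+x. 1 - expm (f' x) \<partial>\<Lambda>)"
    by (intro laplace_poisson[OF pp])
       (auto simp: \<Lambda>_def intro!: sigma_finite_scale_measure lborel.sigma_finite_measure_axioms)
  also have "(\<integral>\<^sup>+x. 1 - expm (f' x) \<partial>\<Lambda>) = ennreal lam * (\<integral>\<^sup>+x. 1 - expm (f' x) \<partial>lborel)"
    unfolding \<Lambda>_def by (rule nn_integral_scale_measure) measurable
  also have "(\<integral>\<^sup>+x. 1 - expm (f' x) \<partial>lborel) = (\<integral>\<^sup>+x. \<integral>\<^sup>+m. 1 - expm (f x m) \<partial>Q \<partial>lborel)"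
  proof (intro nn_integral_cong)
    fix x
    have le: "(\<integral>\<^sup>+m. expm (f x m) \<partial>Q) \<le> 1"
      using nn_integral_mono[of Q "\<lambda>m. expm (f x m)" "\<lambda>_. 1"] by (simp add: Q.emeasure_space_1)
    have "(\<integral>\<^sup>+m. 1 - expm (f x m) \<partial>Q) = (\<integral>\<^sup>+m. 1 \<partial>Q) - (\<integral>\<^sup>+m. expm (f x m) \<partial>Q)"
      using le by (intro nn_integral_diff) (auto simp: top_unique)
    thus "1 - expm (f' x) = (\<integral>\<^sup>+m. 1 - expm (f x m) \<partial>Q)"
      using le by (simp add: f'_def expm_lnm Q.emeasure_space_1)
  qed
  finally show ?thesis .
qed

section \<open>The hypergeometric function\<close>

text \<open>The slit plane is starlike about 0: dividing a point of the slit by a number in (0, 1]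
  does not leave the slit.\<close>

lemma connected_slit_plane: "connected (- (complex_of_real ` {1..}))"
proof (rule starlike_imp_connected, unfold starlike_def, intro bexI[of _ 0] ballI subsetI)
  fix z y assume z: "z \<in> - (complex_of_real ` {1..})" and y: "y \<in> closed_segment 0 z"
  then obtain t where t: "0 \<le> t" "t \<le> 1" "y = of_real t * z"
    by (auto simp: in_segment scaleR_conv_of_real)
  show "y \<in> - (complex_of_real ` {1..})"
  proof
    assume "y \<in> complex_of_real ` {1..}"
    then obtain x where x: "1 \<le> x" "of_real t * z = complex_of_real x" using t by auto
    hence "t > 0" using t by (cases "t = 0") auto
    hence "z = complex_of_real (x / t)" using x by (simp add: field_simps)
    moreover have "1 \<le> x / t" using x t \<open>t > 0\<close> by (simp add: field_simps)
    ultimately show False using z by (metis ComplD atLeast_iff imageI)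
  qed
qed auto

lemma open_slit_plane: "open (- (complex_of_real ` {1..}))"
proof -
  have "complex_of_real ` {1..} = {z. Im z = 0} \<inter> {z. 1 \<le> Re z}"
    by (auto simp: complex_eq_iff image_iff intro: exI[of _ "Re _"])
  moreover have "closed ({z. Im z = 0} \<inter> {z. 1 \<le> Re z})"
    by (intro closed_Int closed_Collect_eq closed_Collect_le continuous_intros)
  ultimately show ?thesis unfolding closed_def by metis
qed

lemma ball_subset_slit_plane: "ball 0 1 \<subseteq> - (complex_of_real ` {1..})"
  by auto

lemma slit_plane_mult_neq_1:
  assumes "z \<in> - (complex_of_real ` {1..})" "0 \<le> u" "u \<le> 1"
  shows "z * of_real u \<noteq> 1"
proof
  assume eq: "z * of_real u = 1"
  hence "u \<noteq> 0" by auto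
  hence "z = complex_of_real (1 / u)" "1 \<le> 1 / u" using eq assms by (auto simp: field_simps)
  thus False using assms(1) by (metis ComplD atLeast_iff imageI)
qed

text \<open>By the identity theorem on the connected slit plane the continuation is unique, so the
  definite description in \<open>hyp2F1\<close> is met by any explicit continuation of the
  series.\<close>

lemma hyp2F1_eqI:
  assumes f: "f holomorphic_on - (complex_of_real ` {1..})"
    and sums: "\<And>u. u \<in> ball 0 1 \<Longrightarrow> (\<lambda>n. fps_nth (fps_hypergeo [a, b] [c] 1) n * u ^ n) sums f u"
    and z: "z \<in> - (complex_of_real ` {1..})"
  shows "hyp2F1 a b c z = f z"
  unfolding hyp2F1_def
proof (rule the_equality)
  fix w assume "\<exists>g. g holomorphic_on - (complex_of_real ` {1..}) \<and>
    (\<forall>u\<in>ball 0 1. (\<lambda>n. fps_nth (fps_hypergeo [a, b] [c] 1) n * u ^ n) sums g u) \<and> w = g z"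
  then obtain g where g: "g holomorphic_on - (complex_of_real ` {1..})" "w = g z"
    "\<And>u. u \<in> ball 0 1 \<Longrightarrow> (\<lambda>n. fps_nth (fps_hypergeo [a, b] [c] 1) n * u ^ n) sums g u" by blast
  have "g z - f z = 0"
  proof (rule analytic_continuation[where f = "\<lambda>z. g z - f z" and U = "ball 0 1" and \<xi> = 0])
    show "(\<lambda>z. g z - f z) holomorphic_on - (complex_of_real ` {1..})"
      by (intro holomorphic_intros f g)
    show "g u - f u = 0" if "u \<in> ball 0 1" for u
      using sums_unique2[OF g(3)[OF that] sums[OF that]] by simp
  qed (use open_slit_plane connected_slit_plane ball_subset_slit_plane z in
        \<open>auto simp: islimpt_ball\<close>)
  thus "w = f z" using g(2) by simp
qed (use f sums in blast)

text \<open>The upper parameter 1 cancels the factorial, and the quotient of the rising factorials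
  of \<open>b\<close> and \<open>b + 1\<close> telescopes.\<close>

lemma fps_hypergeo_1_nth:
  fixes b :: real
  assumes "0 < b"
  shows "fps_nth (fps_hypergeo [1, of_real b] [of_real (b + 1)] 1) n = complex_of_real (b / (b + real n))"
proof -
  have "pochhammer b n * (b + real n) = b * pochhammer (b + 1) n"
    using pochhammer_rec[of b n] pochhammer_Suc[of b n] by simp
  moreover have "pochhammer (b + 1) n \<noteq> 0" using assms pochhammer_pos[of "b + 1" n] by simp
  ultimately have "pochhammer b n / pochhammer (b + 1) n = b / (b + real n)"
    using assms by (simp add: field_simps)
  moreover have "fps_nth (fps_hypergeo [1, of_real b] [of_real (b + 1)] 1) n =
      complex_of_real (pochhammer b n / pochhammer (b + 1) n)"
    by (simp add: pochhammer_fact[symmetric] pochhammer_of_real del: of_real_add)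
  ultimately show ?thesis by simp
qed

text \<open>Euler's integral b * t^(b-1) / (1 - z t) over [0, 1] after the substitution w = t^b.
  This absorbs the weight, singular at 0 for \<open>b < 1\<close>, and leaves a continuous integrand
  on a compact interval.\<close>

lemma hyp2F1_integral:
  fixes b :: real
  assumes b: "0 < b" and z: "z \<in> - (complex_of_real ` {1..})"
  shows "hyp2F1 1 (of_real b) (of_real (b + 1)) z =
         integral {0..1} (\<lambda>w. 1 / (1 - z * of_real (w powr (1 / b))))"
proof (rule hyp2F1_eqI[OF _ _ z])
  define p where "p = 1 / b"
  have p: "0 < p" using b by (simp add: p_def)
  define F where "F z = integral (cbox 0 1) (\<lambda>w. 1 / (1 - z * of_real (w powr p)))" for z :: complex
  have nz: "1 - z * of_real (w powr p) \<noteq> 0" if "z \<in> - (complex_of_real ` {1..})" "w \<in> {0..1}" for z w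
    using slit_plane_mult_neq_1[OF that(1), of "w powr p"] that(2) p powr_mono2[of p w 1] by auto
  have cont: "continuous_on (A \<times> {0..1}) (\<lambda>x. complex_of_real (snd x powr p))" for A :: "complex set"
    using p by (intro continuous_intros continuous_on_powr') auto
  have cont1: "continuous_on {0..1} (\<lambda>w. 1 / (1 - z * of_real (w powr p)))" if "z \<in> - (complex_of_real ` {1..})" for z
    using p nz[OF that] by (intro continuous_intros continuous_on_powr') auto
  show "(\<lambda>z. integral {0..1} (\<lambda>w. 1 / (1 - z * of_real (w powr (1 / b))))) holomorphic_on - (complex_of_real ` {1..})"
    unfolding holomorphic_on_def
  proof
    fix z assume "z \<in> - (complex_of_real ` {1..})"
    then obtain e where e: "e > 0" "ball z e \<subseteq> - (complex_of_real ` {1..})"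
      using open_slit_plane openE by blast
    \<comment> \<open>Differentiation under the integral is done on a small ball, a convex set,
      unlike the slit plane itself.\<close>
    have "F holomorphic_on ball z e"
      unfolding F_def
    proof (rule leibniz_rule_holomorphic)
      fix x t assume "x \<in> ball z e" "t \<in> cbox (0::real) 1"
      hence "1 - x * of_real (t powr p) \<noteq> 0" using nz[of x t] e by auto
      thus "((\<lambda>x. 1 / (1 - x * of_real (t powr p))) has_field_derivative
          (of_real (t powr p) / (1 - x * of_real (t powr p))\<^sup>2)) (at x within ball z e)"
        by (auto intro!: derivative_eq_intros simp: power2_eq_square)
    next
      show "(\<lambda>w. 1 / (1 - x * of_real (w powr p))) integrable_on cbox 0 1" if "x \<in> ball z e" for x
        using that e(2) cont1[of x] by (intro integrable_continuous) auto
      show "continuous_on (ball z e \<times> cbox 0 1) (\<lambda>(x, t). of_real (t powr p) / (1 - x * of_real (t powr p))\<^sup>2)"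
        unfolding split_beta cbox_interval using nz e(2)
        by (intro continuous_intros cont) (auto simp: subset_iff)
    qed auto
    hence "F field_differentiable at z" using e by (intro holomorphic_on_imp_differentiable_at) auto
    thus "(\<lambda>z. integral {0..1} (\<lambda>w. 1 / (1 - z * of_real (w powr (1 / b))))) field_differentiable at z within - (complex_of_real ` {1..})"
      unfolding F_def p_def cbox_interval by (rule field_differentiable_at_within)
  qed
  fix u :: complex assume u: "u \<in> ball 0 1"
  define g where "g w = 1 / (1 - u * of_real (w powr p))" for w :: real
  define S where "S N w = (\<Sum>n<N. (u * of_real (w powr p)) ^ n)" for N and w :: real
  have small: "norm (u * of_real (w powr p)) \<le> norm u" if "w \<in> {0..1}" for w
    using that p powr_mono2[of p w 1] by (auto simp: norm_mult intro: mult_left_le)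
  have power_int: "((\<lambda>w. (u * of_real (w powr p)) ^ n) has_integral (of_real (b / (b + real n)) * u ^ n)) {0..1}" for n
  proof -
    have "((\<lambda>w. w powr (p * real n)) has_integral (1 powr (p * real n + 1) / (p * real n + 1))) {0..1}"
      using p by (intro has_integral_powr_from_0) (auto intro: less_le_trans[of _ 0])
    hence "((\<lambda>w. complex_of_real (w powr (p * real n))) has_integral of_real (b / (b + real n))) {0..1}"
      using b by (intro has_integral_of_real) (simp_all add: p_def field_simps)
    hence I: "((\<lambda>w. u ^ n * complex_of_real (w powr (p * real n))) has_integral (u ^ n * of_real (b / (b + real n)))) {0..1}"
      by (rule has_integral_mult_right)
    have "((\<lambda>w. (u * of_real (w powr p)) ^ n) has_integral (u ^ n * of_real (b / (b + real n)))) {0..1}"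
    \<comment> \<open>The point 0 must be removed: for \<open>n = 0\<close> the left side is 1
      there, but \<open>0 powr 0 = 0\<close> makes the right side vanish.\<close>
    proof (rule has_integral_spike[OF _ _ I])
      show "negligible {0 :: real}" by simp
      fix w :: real assume "w \<in> {0..1} - {0}"
      hence "(w powr p) ^ n = w powr (p * real n)" by (simp add: powr_powr flip: powr_realpow)
      thus "(u * of_real (w powr p)) ^ n = u ^ n * of_real (w powr (p * real n))"
        by (simp add: power_mult_distrib flip: of_real_power)
    qed
    thus ?thesis by (simp add: mult.commute)
  qed
    \<comment> \<open>The geometric series in z w^(1/b) converges uniformly in w, with majorant
      |u|^n, so it may be integrated term by term.\<close>
    have ul: "uniform_limit {0..1} S g sequentially"
    proof -
      have "uniform_limit {0..1} S (\<lambda>w. \<Sum>n. (u * of_real (w powr p)) ^ n) sequentially"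
        unfolding S_def
      proof (rule Weierstrass_m_test)
        show "norm ((u * of_real (w powr p)) ^ n) \<le> norm u ^ n" if "w \<in> {0..1}" for n w
          unfolding norm_power using small[OF that] by (intro power_mono) auto
        show "summable (\<lambda>n. norm u ^ n)" using u by (intro summable_geometric) auto
      qed
      also have "?this \<longleftrightarrow> ?thesis"
      proof (intro uniform_limit_cong' refl)
        fix w :: real assume "w \<in> {0..1}"
        hence "norm (u * of_real (w powr p)) < 1" using small[of w] u by auto
        thus "(\<Sum>n. (u * of_real (w powr p)) ^ n) = g w" unfolding g_def by (rule suminf_geometric)
      qed
      finally show ?thesis .
    qed
    have cont_S: "continuous_on {0..1} (S N)" for N
      unfolding S_def using p by (intro continuous_intros continuous_on_powr') auto
  have "(\<lambda>N. integral {0..1} (S N)) \<longlonglongrightarrow> integral {0..1} g"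
    using uniform_limit_integral[OF ul cont_S] integral_unique by (metis (no_types, lifting) ext sequentially_bot)
  moreover have "integral {0..1} (S N) = (\<Sum>n<N. of_real (b / (b + real n)) * u ^ n)" for N
    unfolding S_def by (intro integral_unique has_integral_sum power_int) auto
  ultimately show "(\<lambda>n. fps_nth (fps_hypergeo [1, of_real b] [of_real (b + 1)] 1) n * u ^ n) sums
      integral {0..1} (\<lambda>w. 1 / (1 - u * of_real (w powr (1 / b))))"
    unfolding sums_def fps_hypergeo_1_nth[OF b] by (simp add: g_def[abs_def] p_def)
qed

text \<open>For y = \<tau>^(-1/\<alpha>) the hypergeometric argument is -\<tau>, the third parameter
  exceeds the second by 1, and the prefactor y^(2-\<alpha>) times \<tau>^(2/\<alpha>) collapses to
  \<tau>.\<close>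

lemma G_fun_eq:
  fixes \<alpha> \<tau> :: real
  assumes "2 < \<alpha>" "0 < \<tau>"
  shows "G_fun ((1 / \<tau>) powr (1 / \<alpha>)) \<alpha> * \<tau> powr (2 / \<alpha>) =
         \<tau> * integral {0..1} (\<lambda>w. 1 / (1 + \<tau> * w powr (\<alpha> / (\<alpha> - 2))))"
proof -
  define b where "b = (\<alpha> - 2) / \<alpha>"
  have b: "0 < b" "(2 * \<alpha> - 2) / \<alpha> = b + 1" "1 / b = \<alpha> / (\<alpha> - 2)" using assms by (auto simp: b_def field_simps)
  define y where "y = (1 / \<tau>) powr (1 / \<alpha>)"
  have y: "y powr - \<alpha> = \<tau>" "y powr (2 - \<alpha>) * \<tau> powr (2 / \<alpha>) = \<tau>"
  proof -
    have ly: "y = \<tau> powr (- 1 / \<alpha>)" using assms by (simp add: y_def powr_divide powr_minus_divide)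
    show "y powr - \<alpha> = \<tau>" using assms by (simp add: ly powr_powr)
    have "y powr (2 - \<alpha>) * \<tau> powr (2 / \<alpha>) = \<tau> powr (- 1 / \<alpha> * (2 - \<alpha>) + 2 / \<alpha>)"
      by (simp only: ly powr_powr powr_add)
    also have "- 1 / \<alpha> * (2 - \<alpha>) + 2 / \<alpha> = 1" using assms by (simp add: field_simps)
    finally show "y powr (2 - \<alpha>) * \<tau> powr (2 / \<alpha>) = \<tau>" using assms by simp
  qed
  have J: "(\<lambda>w. 1 / (1 + \<tau> * w powr (1 / b))) integrable_on {0..1}"
    using b assms by (intro integrable_continuous_interval continuous_intros continuous_on_powr')
      (auto simp: add_nonneg_eq_0_iff)
  have "complex_of_real (- \<tau>) \<in> - (complex_of_real ` {1..})"
    using assms by auto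
  hence "hyp2F1 1 (of_real b) (of_real (b + 1)) (of_real (- \<tau>)) =
        integral {0..1} (\<lambda>w. 1 / (1 - of_real (- \<tau>) * complex_of_real (w powr (1 / b))))"
    by (rule hyp2F1_integral[OF b(1)])
  also have "\<dots> = integral {0..1} (\<lambda>w. complex_of_real (1 / (1 + \<tau> * w powr (1 / b))))"
    by simp
  also have "\<dots> = complex_of_real (integral {0..1} (\<lambda>w. 1 / (1 + \<tau> * w powr (1 / b))))"
    using J by (intro integral_unique has_integral_of_real) (rule integrable_integral)
  finally have "Re (hyp2F1 1 (of_real b) (of_real (b + 1)) (of_real (- \<tau>))) =
      integral {0..1} (\<lambda>w. 1 / (1 + \<tau> * w powr (1 / b)))" by simp
  thus ?thesis
    unfolding G_fun_def y_def[symmetric] y(1) b(2) b_def[symmetric] using y(2) b(3) by (simp add: mult_ac)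
qed

section \<open>Integrals over the plane\<close>

text \<open>Polar coordinates as an image measure: the norm pushes Lebesgue measure forward to the
  density 2 \<pi> t, because both measures give a ray up to \<open>r\<close> the area of the disc of
  radius \<open>r\<close>.\<close>

lemma nn_integral_norm_plane:
  fixes F :: "real \<Rightarrow> ennreal"
  assumes [measurable]: "F \<in> borel_measurable borel"
  shows "(\<integral>\<^sup>+x. F (norm (x :: real ^ 2)) \<partial>lborel) = (\<integral>\<^sup>+t. ennreal (2 * pi * t) * F t \<partial>lborel)"
proof -
  have "distr lborel borel (norm :: real ^ 2 \<Rightarrow> real) = density lborel (\<lambda>t. ennreal (2 * pi * t))"
  proof (rule measure_eqI_generator_eq[where E = "range atMost" and \<Omega> = UNIV and A = "\<lambda>i. {..real i}"])
    show "Int_stable (range (atMost :: real \<Rightarrow> real set))"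
      by (auto intro!: Int_stableI)
    fix X assume "X \<in> range (atMost :: real \<Rightarrow> real set)"
    then obtain r where X: "X = {..r}" by auto
    have 1: "emeasure (distr lborel borel (norm :: real ^ 2 \<Rightarrow> real)) X = emeasure lborel (cball (0 :: real ^ 2) r)"
      by (simp add: X emeasure_distr vimage_def cball_def)
    \<comment> \<open>\<open>ennreal\<close> truncates the density to 0 for negative t, so only the
      part of the ray in \<open>{0..r}\<close> counts.\<close>
    have 2: "emeasure (density lborel (\<lambda>t. ennreal (2 * pi * t))) X =
        (\<integral>\<^sup>+t. ennreal (2 * pi * t) * indicator {0..r} t \<partial>lborel)"
      unfolding X by (simp add: emeasure_density)
        (auto intro!: nn_integral_cong simp: ennreal_neg mult_nonneg_nonpos split: split_indicator)
    show "emeasure (distr lborel borel (norm :: real ^ 2 \<Rightarrow> real)) X =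
        emeasure (density lborel (\<lambda>t. ennreal (2 * pi * t))) X"
    proof (cases "0 \<le> r")
      case True
      have "(\<integral>\<^sup>+t. ennreal (2 * pi * t) * indicator {0..r} t \<partial>lborel) = ennreal (pi * r\<^sup>2 - pi * 0\<^sup>2)"
        using True by (intro nn_integral_FTC_Icc) (auto intro!: derivative_eq_intros)
      thus ?thesis
        using True 1 2 by (simp add: emeasure_cball eval_unit_ball_vol)
    qed (simp add: 1 2)
  next
    show "emeasure (distr lborel borel (norm :: real ^ 2 \<Rightarrow> real)) {..real i} \<noteq> \<infinity>" for i
      using emeasure_cball[of "real i" "0 :: real ^ 2"] by (simp add: emeasure_distr vimage_def cball_def)
  qed (auto simp: borel_eq_atMost real_arch_simple)
  hence "(\<integral>\<^sup>+t. F t \<partial>distr lborel borel (norm :: real ^ 2 \<Rightarrow> real)) = (\<integral>\<^sup>+t. F t \<partial>density lborel (\<lambda>t. ennreal (2 * pi * t)))"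
    by simp
  thus ?thesis by (subst (asm) nn_integral_distr, simp, simp, subst (asm) nn_integral_density) auto
qed

text \<open>Since the integrand is nonnegative, integrability of the pulled-back function is
  absolute; this is what the change of variables theorem requires.\<close>

lemma nn_integral_image_eqI:
  fixes f g g' :: "real \<Rightarrow> real"
  assumes S: "S \<in> sets lebesgue"
    and g: "\<And>x. x \<in> S \<Longrightarrow> (g has_real_derivative g' x) (at x)" "inj_on g S"
    and nonneg: "\<And>y. y \<in> g ` S \<Longrightarrow> 0 \<le> f y"
    and I: "((\<lambda>x. \<bar>g' x\<bar> * f (g x)) has_integral I) S"
  shows "(\<integral>\<^sup>+y. ennreal (f y) * indicator (g ` S) y \<partial>lborel) = ennreal I"
proof -
  have "(\<lambda>x. \<bar>g' x\<bar> * f (g x)) absolutely_integrable_on S"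
    using I nonneg by (intro nonnegative_absolutely_integrable_1) (auto simp: has_integral_integrable_integral)
  moreover have "integral S (\<lambda>x. \<bar>g' x\<bar> * f (g x)) = I" using I by (rule integral_unique)
  ultimately have "f absolutely_integrable_on (g ` S) \<and> integral (g ` S) f = I"
    using has_absolute_integral_change_of_variables_1'[OF S, of g g' f I] g
    by (auto simp: has_real_derivative_iff_has_vector_derivative has_vector_derivative_at_within)
  hence "(f has_integral I) (g ` S)"
    by (auto simp: has_integral_integrable_integral set_lebesgue_integral_eq_integral)
  from nn_integral_has_integral_lebesgue[OF nonneg this] show ?thesis
    by (auto intro!: nn_integral_cong simp: split: split_indicator elim!: trans[rotated])
qed

section \<open>Integrals against the fading law and the serving-distance law\<close>

lemma nn_integral_fading:
  "(\<integral>\<^sup>+h. g h \<partial>fading_law) = (\<integral>\<^sup>+h. ennreal (exp (- h)) * indicator {0..} h * g h \<partial>lborel)"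
  if [measurable]: "g \<in> borel_measurable borel"
  unfolding fading_law_def
  by (subst nn_integral_density)
     (auto intro!: nn_integral_cong simp: exponential_density_def split: split_indicator)

text \<open>One minus the Laplace transform 1 / (1 + s) of a unit exponential. It supplies the
  integrand of every Laplace exponent below.\<close>

lemma fading_law_loss:
  assumes "0 \<le> s"
  shows "(\<integral>\<^sup>+h. 1 - expm (ennreal (s * h)) \<partial>fading_law) = ennreal (s / (1 + s))"
proof -
  define u where "u = 1 + s"
  have u: "1 \<le> u" "0 < u" using assms by (simp_all add: u_def)
  have "(\<integral>\<^sup>+h. 1 - expm (ennreal (s * h)) \<partial>fading_law) =
        (\<integral>\<^sup>+h. ennreal (exp (- h) - exp (- (u * h))) * indicator {0..} h \<partial>lborel)"
  proof (subst nn_integral_fading, measurable, rule nn_integral_cong)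
    fix h :: real
    have "exp (- h) * (1 - exp (- (s * h))) = exp (- h) - exp (- (u * h))"
      by (simp add: algebra_simps mult_exp_exp u_def)
    thus "ennreal (exp (- h)) * indicator {0..} h * (1 - expm (ennreal (s * h))) =
          ennreal (exp (- h) - exp (- (u * h))) * indicator {0..} h"
      using assms ennreal_minus[of "exp (- (s * h))" 1]
      by (cases "0 \<le> h") (simp_all flip: ennreal_mult)
  qed
  also have "\<dots> = ennreal (0 - (- exp (- 0) + exp (- (u * 0)) / u))"
  proof (rule nn_integral_FTC_atLeast)
    fix x :: real
    show "((\<lambda>x. - exp (- x) + exp (- (u * x)) / u) has_real_derivative (exp (- x) - exp (- (u * x)))) (at x)"
      using u by (auto intro!: derivative_eq_intros)
    have "((\<lambda>x::real. - exp (- x)) \<longlongrightarrow> 0) at_top" by real_asymp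
    moreover have "((\<lambda>x. exp (- (u * x)) / u) \<longlongrightarrow> 0) at_top" using u(2) by real_asymp
    ultimately show "((\<lambda>x. - exp (- x) + exp (- (u * x)) / u) \<longlongrightarrow> 0) at_top"
      by (rule tendsto_add_zero)
    assume "0 \<le> x"
    hence "1 * x \<le> u * x" using u by (intro mult_right_mono)
    thus "0 \<le> exp (- x) - exp (- (u * x))" by simp
  qed measurable
  also have "0 - (- exp (- 0) + exp (- (u * 0)) / u) = s / (1 + s)"
    using assms by (simp add: u_def field_simps)
  finally show ?thesis .
qed

lemma emeasure_fading_law_tail:
  assumes "0 \<le> t"
  shows "emeasure fading_law {t<..} = ennreal (exp (- t))"
proof -
  have "emeasure fading_law {t<..} = (\<integral>\<^sup>+h. indicator {t<..} h \<partial>fading_law)"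
    by (simp add: fading_law_def)
  also have "\<dots> = (\<integral>\<^sup>+h. ennreal (exp (- h)) * indicator {t..} h \<partial>lborel)"
    by (subst nn_integral_fading, measurable, intro nn_integral_cong_AE, 
         use AE_lborel_singleton[of t] in eventually_elim)
       (use assms in \<open>auto split: split_indicator\<close>)
  also have "\<dots> = ennreal (0 - (- exp (- t)))"
  proof (rule nn_integral_FTC_atLeast)
    show "((\<lambda>x. - exp (- x)) \<longlongrightarrow> 0) (at_top :: real filter)" by real_asymp
  qed (auto intro!: derivative_eq_intros)
  finally show ?thesis by simp
qed

lemma nn_integral_nearest_bs_law:
  assumes [measurable]: "g \<in> borel_measurable borel" and "0 < lamB"
  shows "(\<integral>\<^sup>+r. g r \<partial>nearest_bs_law lamB) =
         (\<integral>\<^sup>+r. ennreal (2 * pi * lamB * r * exp (- pi * lamB * r\<^sup>2)) * indicator {0..} r * g r \<partial>lborel)"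
  unfolding nearest_bs_law_def
  by (subst nn_integral_density) (auto intro!: nn_integral_cong split: split_indicator)

text \<open>The square of the serving distance is exponential with rate \<pi> \<open>lamB\<close>;
  its Laplace transform is the fraction in the downlink formula.\<close>

lemma nearest_bs_law_expm:
  assumes "0 < lamB" "0 \<le> c"
  shows "(\<integral>\<^sup>+r. expm (ennreal (c * r\<^sup>2)) \<partial>nearest_bs_law lamB) = ennreal (pi * lamB / (pi * lamB + c))"
proof -
  define k where "k = pi * lamB + c"
  have k: "0 < k" unfolding k_def using assms by (simp add: add_pos_nonneg)
  have "(\<integral>\<^sup>+r. expm (ennreal (c * r\<^sup>2)) \<partial>nearest_bs_law lamB) =
        (\<integral>\<^sup>+r. ennreal (2 * pi * lamB * r * exp (- k * r\<^sup>2)) * indicator {0..} r \<partial>lborel)"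
  proof (subst nn_integral_nearest_bs_law[OF _ assms(1)], measurable, rule nn_integral_cong)
    fix r :: real
    have "2 * pi * lamB * r * exp (- pi * lamB * r\<^sup>2) * exp (- (c * r\<^sup>2)) = 2 * pi * lamB * r * exp (- k * r\<^sup>2)"
      by (simp add: k_def mult_exp_exp algebra_simps)
    thus "ennreal (2 * pi * lamB * r * exp (- pi * lamB * r\<^sup>2)) * indicator {0..} r * expm (ennreal (c * r\<^sup>2)) =
          ennreal (2 * pi * lamB * r * exp (- k * r\<^sup>2)) * indicator {0..} r"
      using assms by (auto simp flip: ennreal_mult split: split_indicator)
  qed
  also have "\<dots> = ennreal (0 - (- (pi * lamB / k) * exp (- k * 0\<^sup>2)))"
  proof (rule nn_integral_FTC_atLeast)
    show "((\<lambda>x. - (pi * lamB / k) * exp (- k * x\<^sup>2)) \<longlongrightarrow> 0) (at_top :: real filter)"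
      using k by real_asymp
    show "((\<lambda>x. - (pi * lamB / k) * exp (- k * x\<^sup>2)) has_real_derivative (2 * pi * lamB * x * exp (- k * x\<^sup>2))) (at x)" for x
      using k by (auto intro!: derivative_eq_intros)
  qed (use assms in auto)
  finally show ?thesis by (simp add: k_def)
qed

text \<open>The mean of the same exponential variable. In the uplink it cancels the \<pi> of the
  disc area and the density \<open>lamB\<close> of the interferers, so that exactly
  \<open>K2\<close> remains.\<close>

lemma nearest_bs_law_moment2:
  assumes "0 < lamB"
  shows "(\<integral>\<^sup>+r. ennreal (r\<^sup>2) \<partial>nearest_bs_law lamB) = ennreal (1 / (pi * lamB))"
proof -
  define k where "k = pi * lamB"
  have k: "0 < k" unfolding k_def using assms by simp
  have "(\<integral>\<^sup>+r. ennreal (r\<^sup>2) \<partial>nearest_bs_law lamB) =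
        (\<integral>\<^sup>+r. ennreal (2 * k * r ^ 3 * exp (- k * r\<^sup>2)) * indicator {0..} r \<partial>lborel)"
    by (subst nn_integral_nearest_bs_law[OF _ assms(1)], measurable, rule nn_integral_cong)
       (use assms in \<open>auto simp: k_def power2_eq_square power3_eq_cube mult_ac simp flip: ennreal_mult split: split_indicator\<close>)
  also have "\<dots> = ennreal (0 - (- (0\<^sup>2 + 1 / k) * exp (- k * 0\<^sup>2)))"
  proof (rule nn_integral_FTC_atLeast)
    show "((\<lambda>x. - (x\<^sup>2 + 1 / k) * exp (- k * x\<^sup>2)) \<longlongrightarrow> 0) (at_top :: real filter)"
      using k by real_asymp
    show "((\<lambda>x. - (x\<^sup>2 + 1 / k) * exp (- k * x\<^sup>2)) has_real_derivative (2 * k * x ^ 3 * exp (- k * x\<^sup>2))) (at x)" for x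
      using k by (auto intro!: derivative_eq_intros simp: field_simps power2_eq_square power3_eq_cube)
  qed (use k in auto)
  finally show ?thesis by (simp add: k_def)
qed


text \<open>Substituting w = (r / t)^(\<alpha>-2) makes t^(1-\<alpha>) dt proportional to dw, so
  only the denominator survives. The factor 1 / (\<alpha> - 2) in \<open>K2\<close> is the constant
  of proportionality.\<close>

lemma exclusion_region_integral:
  fixes \<alpha> \<tau> r :: real
  assumes "2 < \<alpha>" "0 < \<tau>" "0 < r"
  shows "(\<integral>\<^sup>+t. ennreal (2 * pi * t * (\<tau> * (r powr \<alpha> * t powr - \<alpha>) / (1 + \<tau> * (r powr \<alpha> * t powr - \<alpha>)))) * indicator {r..} t \<partial>lborel)
         = ennreal (pi * r\<^sup>2 * (2 * \<tau> / (\<alpha> - 2) * integral {0..1} (\<lambda>w. 1 / (1 + \<tau> * w powr (\<alpha> / (\<alpha> - 2))))))"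
proof -
  define p where "p = 1 / (\<alpha> - 2)"
  have p: "0 < p" "p * \<alpha> = \<alpha> / (\<alpha> - 2)" "1 + 2 * p = p * \<alpha>" using assms by (auto simp: p_def field_simps)
  \<comment> \<open>The inverse substitution t = r w^(-p); the value w = 1 is the rim of the disc
    and w = 0 is infinity.\<close>
  define g where "g w = r * w powr - p" for w
  define g' where "g' w = r * (- p * w powr (- p - 1))" for w
  define f where "f t = 2 * pi * t * (\<tau> * (r powr \<alpha> * t powr - \<alpha>) / (1 + \<tau> * (r powr \<alpha> * t powr - \<alpha>)))" for t
  define J where "J w = 1 / (1 + \<tau> * w powr (p * \<alpha>))" for w
  have img: "g ` {0<..1} = {r..}"
  proof (intro equalityI subsetI)
    fix t assume "t \<in> {r..}"
    hence t: "r \<le> t" "0 < t" using assms by auto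
    hence "g ((r / t) powr (1 / p)) = t"
      using p assms by (simp add: g_def powr_powr powr_minus)
    moreover have "(r / t) powr (1 / p) \<in> {0<..1}"
      using p assms t powr_mono2[of "1 / p" "r / t" 1] by auto
    ultimately show "t \<in> g ` {0<..1}" by (metis imageI)
  next
    fix t assume "t \<in> g ` {0<..1}"
    then obtain w where w: "0 < w" "w \<le> 1" "t = r * w powr - p" by (auto simp: g_def)
    have "1 \<le> w powr - p"
      using w p powr_mono2'[of "- p" w 1] by simp
    thus "t \<in> {r..}" using w assms by simp
  qed
  have eq: "\<bar>g' w\<bar> * f (g w) = 2 * pi * r\<^sup>2 * \<tau> * p * J w" if w: "w \<in> {0<..1}" for w
  proof -
    have "g w powr - \<alpha> = r powr - \<alpha> * w powr (p * \<alpha>)"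
      using w assms by (simp add: g_def powr_mult powr_powr)
    hence "r powr \<alpha> * g w powr - \<alpha> = r powr (\<alpha> + - \<alpha>) * w powr (p * \<alpha>)"
      by (simp only: powr_add mult.assoc)
    hence "r powr \<alpha> * g w powr - \<alpha> = w powr (p * \<alpha>)"
      using assms by simp
    \<comment> \<open>The identity \<open>1 + 2 * p = p * \<alpha>\<close> cancels all powers of w
      outside the denominator; it dictates the choice of \<open>p\<close>.\<close>
    moreover have "w powr (- p - 1) * w powr - p * w powr (p * \<alpha>) = 1"
      using w p(3) by (simp flip: powr_add add: algebra_simps)
    ultimately show ?thesis
      using w assms p by (simp add: f_def J_def g'_def abs_mult g_def power2_eq_square field_simps)
  qed
  have "continuous_on {0..1} J"
    unfolding J_def using p assms
    by (intro continuous_intros continuous_on_powr') (auto simp: add_nonneg_eq_0_iff mult_nonneg_nonneg less_imp_neq add_pos_nonneg)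
  hence "(J has_integral integral {0..1} J) {0..1}"
    by (intro integrable_integral integrable_continuous_interval)
  hence "((\<lambda>w. 2 * pi * r\<^sup>2 * \<tau> * p * J w) has_integral 2 * pi * r\<^sup>2 * \<tau> * p * integral {0..1} J) {0..1}"
    by (rule has_integral_mult_right)
  \<comment> \<open>The endpoint 0 is dropped because it has no finite image under
    \<open>g\<close>.\<close>
  hence "((\<lambda>w. 2 * pi * r\<^sup>2 * \<tau> * p * J w) has_integral 2 * pi * r\<^sup>2 * \<tau> * p * integral {0..1} J) {0<..1}"
    by (subst has_integral_spike_set_eq[of _ "{0..1}"]) (auto intro: negligible_subset[of "{0}"])
  hence I: "((\<lambda>w. \<bar>g' w\<bar> * f (g w)) has_integral 2 * pi * r\<^sup>2 * \<tau> * p * integral {0..1} J) {0<..1}"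
    by (subst has_integral_cong[OF eq])
  have "(\<integral>\<^sup>+t. ennreal (f t) * indicator (g ` {0<..1}) t \<partial>lborel) = ennreal (2 * pi * r\<^sup>2 * \<tau> * p * integral {0..1} J)"
  proof (rule nn_integral_image_eqI[where f = f and g = g and g' = g', OF _ _ _ _ I])
    show "(g has_real_derivative g' w) (at w)" if "w \<in> {0<..1}" for w
      using that unfolding g_def g'_def by (auto intro!: derivative_eq_intros)
    show "inj_on g {0<..1}"
    proof (rule inj_onI)
      fix x y :: real assume "x \<in> {0<..1}" "y \<in> {0<..1}" "g x = g y"
      thus "x = y"
        using assms p powr_less_mono2[of p x y] powr_less_mono2[of p y x]
        by (cases x y rule: linorder_cases) (auto simp: g_def powr_minus)
    qed
    show "0 \<le> f t" if "t \<in> g ` {0<..1}" for t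
      using that assms unfolding img f_def by auto
  qed auto
  thus ?thesis
    unfolding img f_def J_def p(2) by (simp add: p_def mult_ac power2_eq_square)
qed

lemma Gamma_reflection_real:
  fixes x :: real
  shows "Gamma x * Gamma (1 - x) = pi / sin (pi * x)"
proof -
  have "complex_of_real (Gamma x * Gamma (1 - x)) = complex_of_real (pi / sin (pi * x))"
    using Gamma_reflection_complex[of "complex_of_real x"]
    by (simp add: Gamma_complex_of_real[symmetric] sin_of_real[symmetric])
  thus ?thesis by (simp only: of_real_eq_iff)
qed

text \<open>With the loss itself, w = s / (1 + s) for s = A t^(-\<alpha>), as the new variable, the
  integral becomes Beta (1 - 2/\<alpha>, 2/\<alpha>). The condition \<alpha> > 2, which gives
  convergence at infinity, makes the first argument positive.\<close>

lemma whole_plane_integral: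
  fixes \<alpha> A :: real
  assumes "2 < \<alpha>" "0 < A"
  shows "(\<integral>\<^sup>+t. ennreal (2 * pi * t * (A * t powr - \<alpha> / (1 + A * t powr - \<alpha>))) * indicator {0<..} t \<partial>lborel)
         = ennreal (2 * pi\<^sup>2 * A powr (2 / \<alpha>) / (\<alpha> * sin (2 * pi / \<alpha>)))"
proof -
  define q where "q = 1 / \<alpha>"
  have q: "0 < q" "2 * q < 1" "\<alpha> * q = 1" using assms by (auto simp: q_def)
  \<comment> \<open>Solves w = s / (1 + s) for t, using s = w / (1 - w).\<close>
  define g where "g w = A powr q * ((1 - w) / w) powr q" for w
  define g' where "g' w = A powr q * (q * ((1 - w) / w) powr (q - 1) * (- 1 / w\<^sup>2))" for w
  define f where "f t = 2 * pi * t * (A * t powr - \<alpha> / (1 + A * t powr - \<alpha>))" for t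
  have s: "A * g w powr - \<alpha> = w / (1 - w)" if "w \<in> {0<..<1}" for w
    using that assms q by (simp add: g_def powr_mult powr_powr powr_minus mult.commute[of q])
  have img: "g ` {0<..<1} = {0<..}"
  proof (intro equalityI subsetI)
    fix t :: real assume t: "t \<in> {0<..}"
    define s where "s = A * t powr - \<alpha>"
    have "0 < s" using t assms by (simp add: s_def)
    hence "(1 - s / (1 + s)) / (s / (1 + s)) = 1 / s" by (simp add: field_simps)
    hence "g (s / (1 + s)) = (A * (1 / s)) powr q" 
      using assms \<open>0 < s\<close> by (simp add: g_def powr_mult powr_divide)
    also have "A * (1 / s) = t powr \<alpha>"
      using assms t by (simp add: s_def powr_minus_divide)
    finally have "g (s / (1 + s)) = t" using q t by (simp add: powr_powr)
    moreover have "s / (1 + s) \<in> {0<..<1}" using \<open>0 < s\<close> by simp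
    ultimately show "t \<in> g ` {0<..<1}" by (metis imageI)
  qed (use assms in \<open>auto simp: g_def\<close>)
  have eq: "\<bar>g' w\<bar> * f (g w) = 2 * pi * A powr (2 * q) * q * (w powr ((1 - 2 * q) - 1) * (1 - w) powr (2 * q - 1))"
    if w: "w \<in> {0<..<1}" for w
  proof -
    have 1: "f (g w) = 2 * pi * g w * w"
      unfolding f_def s[OF w] using w by (simp add: field_simps)
    have 2: "\<bar>g' w\<bar> = A powr q * (q * ((1 - w) / w) powr (q - 1) * (1 / w\<^sup>2))"
      unfolding g'_def using w q by (simp add: abs_mult)
    have "((1 - w) / w) powr (q - 1) * ((1 - w) / w) powr q * (w / w\<^sup>2) = ((1 - w) / w) powr (2 * q - 1) * (1 / w)"
      using w by (simp add: power2_eq_square flip: powr_add)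
    also have "\<dots> = (1 - w) powr (2 * q - 1) * (w powr (1 - 2 * q) / w powr 1)"
      using w by (simp add: powr_divide powr_minus_divide[of w "2 * q - 1", simplified])
    also have "w powr (1 - 2 * q) / w powr 1 = w powr ((1 - 2 * q) - 1)"
      using w by (simp only: powr_diff)
    finally have 3: "((1 - w) / w) powr (q - 1) * ((1 - w) / w) powr q * (w / w\<^sup>2) =
      (1 - w) powr (2 * q - 1) * w powr ((1 - 2 * q) - 1)" .
    have "\<bar>g' w\<bar> * f (g w) = 2 * pi * (A powr q * A powr q) * q * (((1 - w) / w) powr (q - 1) * ((1 - w) / w) powr q * (w / w\<^sup>2))"
      unfolding 1 2 unfolding g_def by simp
    also have "A powr q * A powr q = A powr (2 * q)" by (simp flip: powr_add)
    finally show ?thesis unfolding 3 by (simp add: mult_ac)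
  qed
  have "((\<lambda>w. w powr ((1 - 2 * q) - 1) * (1 - w) powr (2 * q - 1)) has_integral Beta (1 - 2 * q) (2 * q)) {0<..<1}"
    using has_integral_Beta_real[of "1 - 2 * q" "2 * q"] q by (simp add: has_integral_Icc_iff_Ioo)
  from has_integral_mult_right[OF this, of "2 * pi * A powr (2 * q) * q"]
  have I: "((\<lambda>w. \<bar>g' w\<bar> * f (g w)) has_integral 2 * pi * A powr (2 * q) * q * Beta (1 - 2 * q) (2 * q)) {0<..<1}"
    by (subst has_integral_cong[OF eq])
  have "(\<integral>\<^sup>+t. ennreal (f t) * indicator (g ` {0<..<1}) t \<partial>lborel) = ennreal (2 * pi * A powr (2 * q) * q * Beta (1 - 2 * q) (2 * q))"
  proof (rule nn_integral_image_eqI[where f = f and g = g and g' = g', OF _ _ _ _ I])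
    show "(g has_real_derivative g' w) (at w)" if "w \<in> {0<..<1}" for w
    proof -
      have "((\<lambda>w. (1 - w) / w) has_real_derivative (- 1 / w\<^sup>2)) (at w)"
        using that by (auto intro!: derivative_eq_intros simp: field_simps power2_eq_square)
      thus ?thesis
        using that unfolding g_def g'_def
        by (auto intro!: derivative_eq_intros simp: power2_eq_square)
    qed
    show "inj_on g {0<..<1}"
    proof (rule inj_onI)
      fix x y :: real assume "x \<in> {0<..<1}" "y \<in> {0<..<1}" "g x = g y"
      hence "x / (1 - x) = y / (1 - y)" using s[of x] s[of y] by simp
      thus "x = y" using \<open>x \<in> _\<close> \<open>y \<in> _\<close> by (simp add: field_simps)
    qed
    show "0 \<le> f t" if "t \<in> g ` {0<..<1}" for t
      using that assms unfolding img f_def by auto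
  qed auto
  \<comment> \<open>The two arguments add up to 1, so the denominator of Beta is Gamma 1 and the
    reflection formula applies.\<close>
  moreover have "Beta (1 - 2 * q) (2 * q) = pi / sin (pi * (2 * q))"
    using Gamma_reflection_real[of "2 * q"] by (simp add: Beta_def mult.commute)
  ultimately show ?thesis
    unfolding img f_def by (simp add: q_def mult_ac power2_eq_square)
qed

section \<open>Access probabilities\<close>

text \<open>A negative binomial law: with z = m / (b + m) the weights are the terms of the binomial
  series of (1 - z)^(-b), multiplied by (1 - z)^b.\<close>

lemma num_users_prob_sums:
  assumes "0 < lamB" "0 < lamU"
  shows "num_users_prob lamB lamU n \<ge> 0" "num_users_prob lamB lamU sums 1"
proof -
  define b :: real where "b = 3.575"
  define m where "m = lamU / lamB"
  have bm: "0 < b" "0 < m" using assms by (auto simp: b_def m_def)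
  define z where "z = m / (b + m)"
  have z: "0 < z" "z < 1" "1 - z = b / (b + m)" using bm by (auto simp: z_def field_simps)
  have eq: "num_users_prob lamB lamU n = ((- b) gchoose n) * (- z) ^ n * (b / (b + m)) powr b" for n
  proof -
    have b_nonpos: "b \<notin> \<int>\<^sub>\<le>\<^sub>0" using bm nonpos_Ints_nonpos[of b] by auto
    have "Gamma (real n + b) = pochhammer b n * Gamma b"
      using pochhammer_Gamma[OF b_nonpos, of n] Gamma_real_pos[OF bm(1)] by (simp add: add.commute)
    moreover have "Gamma (real n + 1) = fact n" by (simp add: Gamma_fact add.commute)
    moreover have "((- b) gchoose n) * (- z) ^ n = pochhammer b n / fact n * z ^ n"
    proof -
      have "(- 1) ^ n * (- z) ^ n = z ^ n" by (simp flip: power_mult_distrib)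
      thus ?thesis by (simp add: gbinomial_pochhammer mult_ac)
    qed
    moreover have "(b + m) powr (real n + b) = (b + m) ^ n * (b + m) powr b"
      using bm by (simp add: powr_add powr_realpow)
    moreover have "z ^ n = m ^ n / (b + m) ^ n" "(b / (b + m)) powr b = b powr b / (b + m) powr b"
      using bm by (simp_all add: z_def power_divide powr_divide)
    moreover have "Gamma b \<noteq> 0" using Gamma_real_pos[OF bm(1)] by simp
    ultimately show ?thesis
      unfolding num_users_prob_def Let_def b_def[symmetric] m_def[symmetric] by (simp add: mult_ac)
  qed
  show "num_users_prob lamB lamU n \<ge> 0"
    unfolding num_users_prob_def Let_def using assms by (auto intro!: mult_nonneg_nonneg divide_nonneg_nonneg Gamma_real_nonneg simp: add_nonneg_pos)
  have "(\<lambda>n. ((- b) gchoose n) * (- z) ^ n) sums (1 + - z) powr (- b)"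
    using z by (intro gen_binomial_real) auto
  hence "(\<lambda>n. ((- b) gchoose n) * (- z) ^ n * (b / (b + m)) powr b) sums ((b / (b + m)) powr (- b) * (b / (b + m)) powr b)"
    using z(3) by (intro sums_mult2) simp
  moreover have "(b / (b + m)) powr (- b) * (b / (b + m)) powr b = 1"
    using bm by (simp flip: powr_add)
  moreover have "num_users_prob lamB lamU = (\<lambda>n. ((- b) gchoose n) * (- z) ^ n * (b / (b + m)) powr b)"
    by (rule ext) (rule eq)
  ultimately show "num_users_prob lamB lamU sums 1" by (simp only:)
qed

lemma weighted_num_users_prob_le_1:
  assumes "0 < lamB" "0 < lamU" "\<And>n. n < K \<Longrightarrow> w n \<le> 1"
  shows "(\<Sum>n<K. w n * num_users_prob lamB lamU n) \<le> 1"
proof -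
  have "(\<Sum>n<K. w n * num_users_prob lamB lamU n) \<le> (\<Sum>n<K. 1 * num_users_prob lamB lamU n)"
    using assms by (intro sum_mono mult_right_mono num_users_prob_sums) auto
  also have "\<dots> \<le> 1"
    using sum_le_suminf[of "num_users_prob lamB lamU" "{..<K}"] num_users_prob_sums[OF assms(1,2)]
    by (simp add: sums_iff)
  finally show ?thesis .
qed

text \<open>Needed because the process intensity passes through \<open>ennreal\<close>, which would
  truncate a negative value, whereas the closed formula would retain it. Each access probability is
  1 minus a sum of user probabilities with weights at most 1.\<close>

lemma access_prob_nonneg:
  assumes "0 < lamB" "0 < lamU" "2 \<le> K"
  shows "0 \<le> access_prob_other pol lamB lamU K" "0 \<le> access_prob_d2d pol lamB lamU K"
  using assms weighted_num_users_prob_le_1[OF assms(1,2), of K "\<lambda>n. (real K - real n) / real K"]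
    weighted_num_users_prob_le_1[OF assms(1,2), of K "\<lambda>n. (real K - real n - 1) / (real K - 1)"]
    weighted_num_users_prob_le_1[OF assms(1,2), of K "\<lambda>n. 1"]
  unfolding uniform_access_prob_def by (cases pol; simp add: uniform_access_prob_def)+

section \<open>Coverage probabilities\<close>

lemma sets_fading_law [simp, measurable_cong]: "sets fading_law = sets borel"
  by (simp add: fading_law_def)

lemma sets_nearest_bs_law [simp, measurable_cong]: "sets (nearest_bs_law lamB) = sets borel"
  by (simp add: nearest_bs_law_def)

lemma space_fading_law [simp]: "space fading_law = UNIV"
  by (simp add: fading_law_def)

lemma sets_user_power_law [simp, measurable_cong]: "sets (user_power_law \<alpha> lamB rho) = sets borel"
  by (simp add: user_power_law_def)

lemma prob_space_fading_law: "prob_space fading_law"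
  unfolding fading_law_def by (rule prob_space_exponential_density) simp

lemma prob_space_nearest_bs_law:
  assumes "0 < lamB" shows "prob_space (nearest_bs_law lamB)"
proof
  have "emeasure (nearest_bs_law lamB) (space (nearest_bs_law lamB)) = (\<integral>\<^sup>+r. expm (ennreal (0 * r\<^sup>2)) \<partial>nearest_bs_law lamB)"
    by simp
  also have "\<dots> = 1" using assms by (subst nearest_bs_law_expm) auto
  finally show "emeasure (nearest_bs_law lamB) (space (nearest_bs_law lamB)) = 1" .
qed

lemma AE_nearest_bs_law_pos: "AE r in nearest_bs_law lamB. 0 < r"
  unfolding nearest_bs_law_def by (subst AE_density) auto

lemma prob_space_user_power_law:
  assumes "0 < lamB" shows "prob_space (user_power_law \<alpha> lamB rho)"
  unfolding user_power_law_def
  by (rule prob_space.prob_space_distr[OF prob_space_nearest_bs_law[OF assms]]) measurable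

lemma measurable_sinr [measurable]:
  assumes [measurable]: "f \<in> borel_measurable M" "g \<in> borel_measurable M"
  shows "(\<lambda>x. sinr (f x) (g x)) \<in> borel_measurable M"
  unfolding sinr_def by measurable

text \<open>Coverage means that the fading exceeds \<tau> I / \<kappa>. The conventions fit: zero
  interference gives certain coverage and infinite interference none. Negative fading values, where
  \<open>ennreal\<close> truncates the signal to 0, lie below the threshold whenever the
  interference is positive and finite.\<close>

lemma fading_sinr_tail:
  assumes "0 < \<kappa>" "0 < \<tau>"
  shows "emeasure fading_law {x. ennreal \<tau> < sinr (ennreal (\<kappa> * x)) I} = expm (ennreal (\<tau> / \<kappa>) * I)"
proof (cases I)
  case top
  hence "{x. ennreal \<tau> < sinr (ennreal (\<kappa> * x)) I} = {}" by (auto simp: sinr_def)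
  thus ?thesis using top assms by (simp add: ennreal_mult_top)
next
  case (real i)
  show ?thesis
  proof (cases "i = 0")
    case True
    thus ?thesis using real prob_space.emeasure_space_1[OF prob_space_fading_law] by (simp add: sinr_def)
  next
    case False
    hence i: "0 < i" using real by simp
    have "ennreal \<tau> < sinr (ennreal (\<kappa> * x)) I \<longleftrightarrow> \<tau> / \<kappa> * i < x" for x
    proof (cases "0 \<le> x")
      case True
      thus ?thesis
        using i assms real by (simp add: sinr_def divide_ennreal ennreal_less_iff field_simps)
    next
      case False
      hence "ennreal (\<kappa> * x) = 0" using assms by (simp add: ennreal_neg mult_pos_neg less_imp_le)
      moreover have "0 \<le> \<tau> / \<kappa> * i" using assms i by simp
      ultimately show ?thesis
        using False i real by (auto simp: sinr_def)
    qed
    hence "{x. ennreal \<tau> < sinr (ennreal (\<kappa> * x)) I} = {\<tau> / \<kappa> * i<..}" by auto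
    thus ?thesis
      using i assms real by (simp add: emeasure_fading_law_tail flip: ennreal_mult)
  qed
qed

text \<open>\<open>Y\<close> collects everything except the signal fading, and \<kappa> is the mean
  received signal. Freezing \<open>Y\<close> leaves an exponential tail. Positivity of \<kappa> is
  asked only almost surely, as the serving distance is positive only almost surely.\<close>

lemma coverage_probability:
  assumes M: "prob_space M" and indep: "mutually_indep M (gen_sets M borel h # Fs)"
    and h [measurable]: "h \<in> borel_measurable M" and h_law: "distr M borel h = fading_law"
    and Y [measurable]: "Y \<in> M \<rightarrow>\<^sub>M N"
    and Y_gen: "Y \<in> sigma (space M) (\<Union>(set Fs)) \<rightarrow>\<^sub>M N"
    and stable: "\<forall>F\<in>set Fs. Int_stable F"
    and [measurable]: "\<kappa> \<in> borel_measurable N" "I \<in> borel_measurable N"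
    and pos: "AE \<omega> in M. 0 < \<kappa> (Y \<omega>)" and "0 < \<tau>"
  shows "emeasure M {\<omega> \<in> space M. ennreal \<tau> < sinr (ennreal (\<kappa> (Y \<omega>) * h \<omega>)) (I (Y \<omega>))} =
         (\<integral>\<^sup>+\<omega>. expm (ennreal (\<tau> / \<kappa> (Y \<omega>)) * I (Y \<omega>)) \<partial>M)"
proof -
  interpret prob_space M by fact
  define f :: "real \<Rightarrow> 'b \<Rightarrow> ennreal" where
    "f x y = (if ennreal \<tau> < sinr (ennreal (\<kappa> y * x)) (I y) then 1 else 0)" for x y
  have f: "(\<lambda>(x, y). f x y) \<in> borel_measurable (borel \<Otimes>\<^sub>M N)"
    unfolding f_def by measurable
  have "emeasure M {\<omega> \<in> space M. ennreal \<tau> < sinr (ennreal (\<kappa> (Y \<omega>) * h \<omega>)) (I (Y \<omega>))} =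
        (\<integral>\<^sup>+\<omega>. f (h \<omega>) (Y \<omega>) \<partial>M)"
    (is "emeasure M ?S = _")
  proof -
    have "emeasure M ?S = (\<integral>\<^sup>+\<omega>. indicator ?S \<omega> \<partial>M)"
      by (rule nn_integral_indicator[symmetric]) measurable
    also have "\<dots> = (\<integral>\<^sup>+\<omega>. f (h \<omega>) (Y \<omega>) \<partial>M)"
      by (intro nn_integral_cong) (auto simp: f_def)
    finally show ?thesis .
  qed
  also have "\<dots> = (\<integral>\<^sup>+\<omega>'. \<integral>\<^sup>+\<omega>. f (h \<omega>) (Y \<omega>') \<partial>M \<partial>M)"
    by (rule nn_integral_pair_indep(2)[OF M indep h Y Y_gen stable f])
  also have "\<dots> = (\<integral>\<^sup>+\<omega>. expm (ennreal (\<tau> / \<kappa> (Y \<omega>)) * I (Y \<omega>)) \<partial>M)"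
  proof (intro nn_integral_cong_AE, use pos in eventually_elim)
    case (elim \<omega>')
    have [measurable]: "{x. ennreal \<tau> < sinr (ennreal (\<kappa> (Y \<omega>') * x)) (I (Y \<omega>'))} \<in> sets borel"
      by measurable
    have "(\<integral>\<^sup>+\<omega>. f (h \<omega>) (Y \<omega>') \<partial>M) = (\<integral>\<^sup>+x. f x (Y \<omega>') \<partial>distr M borel h)"
      by (subst nn_integral_distr) (auto simp: f_def)
    also have "\<dots> = (\<integral>\<^sup>+x. indicator {x. ennreal \<tau> < sinr (ennreal (\<kappa> (Y \<omega>') * x)) (I (Y \<omega>'))} x \<partial>fading_law)"
      unfolding h_law by (intro nn_integral_cong) (auto simp: f_def split: split_indicator)
    also have "\<dots> = expm (ennreal (\<tau> / \<kappa> (Y \<omega>')) * I (Y \<omega>'))"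
      using fading_sinr_tail[OF elim \<open>0 < \<tau>\<close>] by (subst nn_integral_indicator) auto
    finally show ?case .
  qed
  finally show ?thesis .
qed

text \<open>For \<alpha> > 2 and \<tau> > 0 this is the coefficient of \<open>qhat\<close> in
  \<open>K2\<close>, with \<open>G_fun\<close> replaced by its integral.\<close>

definition exclusion_const :: "real \<Rightarrow> real \<Rightarrow> real" where
  "exclusion_const \<alpha> \<tau> = 2 * \<tau> / (\<alpha> - 2) * integral {0..1} (\<lambda>w. 1 / (1 + \<tau> * w powr (\<alpha> / (\<alpha> - 2))))"

lemma exclusion_const_nonneg: "2 < \<alpha> \<Longrightarrow> 0 < \<tau> \<Longrightarrow> 0 \<le> exclusion_const \<alpha> \<tau>"
  unfolding exclusion_const_def
  by (intro mult_nonneg_nonneg, simp, cases "(\<lambda>w. 1 / (1 + \<tau> * w powr (\<alpha> / (\<alpha> - 2)))) integrable_on {0..1}")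
     (auto intro!: integral_nonneg simp: not_integrable_integral)

text \<open>The predicate \<open>P\<close> leaves the boundary circle open, since the downlink
  excludes it and the uplink includes it; the circle is a null set.\<close>

lemma exclusion_plane_integral:
  fixes \<alpha> \<tau> r :: real
  assumes "2 < \<alpha>" "0 < \<tau>" "0 < r" and P: "\<And>t. r < t \<Longrightarrow> P t" "\<And>t. t < r \<Longrightarrow> \<not> P t"
    and [measurable]: "Measurable.pred borel P"
  shows "(\<integral>\<^sup>+x. (if P (norm (x :: real ^ 2)) then ennreal (\<tau> * (r powr \<alpha> * norm x powr - \<alpha>) / (1 + \<tau> * (r powr \<alpha> * norm x powr - \<alpha>))) else 0) \<partial>lborel)
         = ennreal (pi * r\<^sup>2 * exclusion_const \<alpha> \<tau>)"
proof -
  have "(\<integral>\<^sup>+x. (if P (norm (x :: real ^ 2)) then ennreal (\<tau> * (r powr \<alpha> * norm x powr - \<alpha>) / (1 + \<tau> * (r powr \<alpha> * norm x powr - \<alpha>))) else 0) \<partial>lborel) =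
    (\<integral>\<^sup>+t. ennreal (2 * pi * t) * (if P t then ennreal (\<tau> * (r powr \<alpha> * t powr - \<alpha>) / (1 + \<tau> * (r powr \<alpha> * t powr - \<alpha>))) else 0) \<partial>lborel)"
    by (rule nn_integral_norm_plane) measurable
  also have "\<dots> = (\<integral>\<^sup>+t. ennreal (2 * pi * t * (\<tau> * (r powr \<alpha> * t powr - \<alpha>) / (1 + \<tau> * (r powr \<alpha> * t powr - \<alpha>)))) * indicator {r..} t \<partial>lborel)"
  proof (intro nn_integral_cong_AE, use AE_lborel_singleton[of r] in eventually_elim)
    case (elim t)
    thus ?case
    proof (cases t r rule: linorder_cases)
      case greater
      thus ?thesis using P(1)[OF greater] assms by (simp flip: ennreal_mult')
    qed (use P(2) in auto)
  qed
  also have "\<dots> = ennreal (pi * r\<^sup>2 * exclusion_const \<alpha> \<tau>)"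
    unfolding exclusion_const_def by (rule exclusion_region_integral) fact+
  finally show ?thesis .
qed

section \<open>Laplace transforms of the D2D, downlink and uplink interference\<close>

lemma laplace_d2d_interference:
  assumes ppp: "marked_ppp M lam fading_law \<Psi>" and "2 < \<beta>" "0 < c" "0 < PD"
  shows "(\<integral>\<^sup>+\<omega>. expm (ennreal c * d2d_interference \<beta> PD (\<Psi> \<omega>)) \<partial>M) =
         expm (ennreal lam * ennreal (2 * pi\<^sup>2 * (c * PD) powr (2 / \<beta>) / (\<beta> * sin (2 * pi / \<beta>))))"
proof -
  define A where "A = c * PD"
  have A: "0 < A" using assms by (simp add: A_def)
  have "(\<integral>\<^sup>+\<omega>. expm (ennreal c * d2d_interference \<beta> PD (\<Psi> \<omega>)) \<partial>M) =
        (\<integral>\<^sup>+\<omega>. expm (point_sum (\<lambda>(y, h). ennreal (A * norm y powr - \<beta> * h)) (\<Psi> \<omega>)) \<partial>M)"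
    unfolding d2d_interference_def point_sum_cmult[symmetric] split_beta A_def
    using assms by (simp add: mult_ac flip: ennreal_mult')
  also have "\<dots> = expm (ennreal lam * (\<integral>\<^sup>+x. \<integral>\<^sup>+h. 1 - expm (ennreal (A * norm (x :: real ^ 2) powr - \<beta> * h)) \<partial>fading_law \<partial>lborel))"
    by (rule laplace_marked_ppp[OF ppp, of "\<lambda>y h. ennreal (A * norm y powr - \<beta> * h)"]) measurable
  also have "(\<integral>\<^sup>+x. \<integral>\<^sup>+h. 1 - expm (ennreal (A * norm (x :: real ^ 2) powr - \<beta> * h)) \<partial>fading_law \<partial>lborel) =
      (\<integral>\<^sup>+x. ennreal (A * norm (x :: real ^ 2) powr - \<beta> / (1 + A * norm x powr - \<beta>)) \<partial>lborel)"
    using A by (intro nn_integral_cong fading_law_loss) simp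
  also have "\<dots> = (\<integral>\<^sup>+t. ennreal (2 * pi * t) * ennreal (A * t powr - \<beta> / (1 + A * t powr - \<beta>)) \<partial>lborel)"
    by (rule nn_integral_norm_plane) measurable
  also have "\<dots> = (\<integral>\<^sup>+t. ennreal (2 * pi * t * (A * t powr - \<beta> / (1 + A * t powr - \<beta>))) * indicator {0<..} t \<partial>lborel)"
    using A by (intro nn_integral_cong) (auto simp: ennreal_neg mult_nonneg_nonpos simp flip: ennreal_mult' split: split_indicator)
  also have "\<dots> = ennreal (2 * pi\<^sup>2 * A powr (2 / \<beta>) / (\<beta> * sin (2 * pi / \<beta>)))"
    by (rule whole_plane_integral) fact+
  finally show ?thesis by (simp add: A_def)
qed

text \<open>The argument is \<tau> over the mean signal at distance \<open>r\<close>, so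
  \<open>PB\<close> cancels and each loss depends only on the ratio of \<open>r\<close> to the
  distance of the interferer.\<close>

lemma laplace_downlink_interference:
  assumes ppp: "marked_ppp M lam fading_law \<Phi>" and "2 < \<alpha>" "0 < \<tau>" "0 < PB" "0 < r"
  shows "(\<integral>\<^sup>+\<omega>. expm (ennreal (\<tau> * r powr \<alpha> / PB) * downlink_interference \<alpha> PB r (\<Phi> \<omega>)) \<partial>M) =
         expm (ennreal lam * ennreal (pi * r\<^sup>2 * exclusion_const \<alpha> \<tau>))"
proof -
  define s where "s x = \<tau> * (r powr \<alpha> * norm x powr - \<alpha>)" for x :: "real ^ 2"
  have s: "0 \<le> s x" for x using assms by (simp add: s_def)
  have "(\<integral>\<^sup>+\<omega>. expm (ennreal (\<tau> * r powr \<alpha> / PB) * downlink_interference \<alpha> PB r (\<Phi> \<omega>)) \<partial>M) =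
        (\<integral>\<^sup>+\<omega>. expm (point_sum (\<lambda>(x, h). if r < norm x then ennreal (s x * h) else 0) (\<Phi> \<omega>)) \<partial>M)"
    unfolding downlink_interference_def point_sum_cmult[symmetric] split_beta
    using assms by (auto intro!: nn_integral_cong arg_cong[where f = expm] arg_cong2[where f = point_sum]
      simp: s_def mult_ac simp flip: ennreal_mult')
  also have "\<dots> = expm (ennreal lam * (\<integral>\<^sup>+x. \<integral>\<^sup>+h. 1 - expm (if r < norm x then ennreal (s x * h) else 0) \<partial>fading_law \<partial>lborel))"
    by (rule laplace_marked_ppp[OF ppp, of "\<lambda>x h. if r < norm x then ennreal (s x * h) else 0"]) (unfold s_def, measurable)
  also have "(\<integral>\<^sup>+x. \<integral>\<^sup>+h. 1 - expm (if r < norm x then ennreal (s x * h) else 0) \<partial>fading_law \<partial>lborel) =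
      (\<integral>\<^sup>+x. (if r < norm x then ennreal (s x / (1 + s x)) else 0) \<partial>lborel)"
    by (intro nn_integral_cong) (auto simp: fading_law_loss s)
  also have "\<dots> = ennreal (pi * r\<^sup>2 * exclusion_const \<alpha> \<tau>)"
    unfolding s_def using assms by (intro exclusion_plane_integral) auto
  finally show ?thesis .
qed

text \<open>For power rhob r^\<alpha> the excluded disc has radius exactly r, and the received power
  is scaled by the same r. Each power therefore contributes the downlink integral at its own r, to
  be averaged over the mark.\<close>

lemma laplace_uplink_interference:
  assumes ppp: "marked_ppp M lam (user_power_law \<alpha> lamB rhob \<Otimes>\<^sub>M fading_law) \<Phi>"
    and "2 < \<alpha>" "0 < \<tau>" "0 < rhob" "0 < lamB"
  shows "(\<integral>\<^sup>+\<omega>. expm (ennreal (\<tau> / rhob) * uplink_interference \<alpha> rhob (\<Phi> \<omega>)) \<partial>M) =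
         expm (ennreal lam * ennreal (exclusion_const \<alpha> \<tau> / lamB))"
proof -
  define Pu where "Pu = user_power_law \<alpha> lamB rhob"
  interpret Pu: prob_space Pu unfolding Pu_def using assms by (intro prob_space_user_power_law)
  interpret fad: prob_space fading_law by (rule prob_space_fading_law)
  interpret LP: pair_sigma_finite Pu "lborel :: (real ^ 2) measure" ..
  have [measurable_cong, simp]: "sets Pu = sets borel" by (simp add: Pu_def)
  define f where "f u P h = (if (P / rhob) powr (1 / \<alpha>) \<le> norm u then ennreal (\<tau> / rhob * P * norm u powr - \<alpha> * h) else 0)"
    for u :: "real ^ 2" and P h :: real
  have [measurable (raw)]: "(\<lambda>x. f (u x) (P x) (h x)) \<in> borel_measurable N"
    if [measurable]: "u \<in> borel_measurable N" "P \<in> borel_measurable N" "h \<in> borel_measurable N" for u P h N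
    unfolding f_def by measurable
  have "(\<integral>\<^sup>+\<omega>. expm (ennreal (\<tau> / rhob) * uplink_interference \<alpha> rhob (\<Phi> \<omega>)) \<partial>M) =
        (\<integral>\<^sup>+\<omega>. expm (point_sum (\<lambda>(u, m). f u (fst m) (snd m)) (\<Phi> \<omega>)) \<partial>M)"
    unfolding uplink_interference_def point_sum_cmult[symmetric] split_beta f_def
    using assms by (auto intro!: nn_integral_cong arg_cong[where f = expm] arg_cong2[where f = point_sum]
      simp: mult_ac simp flip: ennreal_mult')
  also have "\<dots> = expm (ennreal lam * (\<integral>\<^sup>+u. \<integral>\<^sup>+m. 1 - expm (f u (fst m) (snd m)) \<partial>(Pu \<Otimes>\<^sub>M fading_law) \<partial>lborel))"
    by (rule laplace_marked_ppp[OF ppp[folded Pu_def], of "\<lambda>u m. f u (fst m) (snd m)"]) measurable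
  also have "(\<integral>\<^sup>+u. \<integral>\<^sup>+m. 1 - expm (f u (fst m) (snd m)) \<partial>(Pu \<Otimes>\<^sub>M fading_law) \<partial>lborel) =
      (\<integral>\<^sup>+u. \<integral>\<^sup>+P. \<integral>\<^sup>+h. 1 - expm (f u P h) \<partial>fading_law \<partial>Pu \<partial>lborel)"
    by (intro nn_integral_cong, subst fad.nn_integral_fst[symmetric]) (simp_all, measurable)
  \<comment> \<open>The order is swapped because the disc excluded for an interferer depends on its
    power: the plane integral is explicit only once the power is fixed.\<close>
  also have "\<dots> = (\<integral>\<^sup>+P. \<integral>\<^sup>+u. \<integral>\<^sup>+h. 1 - expm (f u P h) \<partial>fading_law \<partial>lborel \<partial>Pu)"
    by (rule LP.Fubini') measurable
  also have "\<dots> = (\<integral>\<^sup>+r. \<integral>\<^sup>+u. \<integral>\<^sup>+h. 1 - expm (f u (rhob * r powr \<alpha>) h) \<partial>fading_law \<partial>lborel \<partial>nearest_bs_law lamB)"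
    unfolding Pu_def user_power_law_def by (rule nn_integral_distr) measurable
  also have "\<dots> = (\<integral>\<^sup>+r. ennreal (pi * exclusion_const \<alpha> \<tau>) * ennreal (r\<^sup>2) \<partial>nearest_bs_law lamB)"
  proof (intro nn_integral_cong_AE, use AE_nearest_bs_law_pos[of lamB] in eventually_elim)
    case (elim r)
    define s where "s u = \<tau> * (r powr \<alpha> * norm u powr - \<alpha>)" for u :: "real ^ 2"
    have s: "0 \<le> s x" for x using assms by (simp add: s_def)
    have f_eq: "f u (rhob * r powr \<alpha>) h = (if r \<le> norm u then ennreal (s u * h) else 0)" for u h
      using elim assms by (simp add: f_def s_def powr_powr mult_ac)
    have "(\<integral>\<^sup>+u. \<integral>\<^sup>+h. 1 - expm (f u (rhob * r powr \<alpha>) h) \<partial>fading_law \<partial>lborel) =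
        (\<integral>\<^sup>+u. (if r \<le> norm u then ennreal (s u / (1 + s u)) else 0) \<partial>lborel)"
      unfolding f_eq by (intro nn_integral_cong) (auto simp: fading_law_loss s)
    also have "\<dots> = ennreal (pi * r\<^sup>2 * exclusion_const \<alpha> \<tau>)"
      unfolding s_def using assms elim by (intro exclusion_plane_integral) auto
    finally show ?case
      using exclusion_const_nonneg assms by (simp add: mult_ac flip: ennreal_mult)
  qed
  also have "\<dots> = ennreal (pi * exclusion_const \<alpha> \<tau>) * ennreal (1 / (pi * lamB))"
    using assms by (subst nn_integral_cmult) (simp_all add: nearest_bs_law_moment2)
  also have "\<dots> = ennreal (exclusion_const \<alpha> \<tau> / lamB)"
    using assms exclusion_const_nonneg[of \<alpha> \<tau>] by (subst ennreal_mult[symmetric]) auto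
  finally show ?thesis .
qed

section \<open>Assembling the coverage probabilities\<close>

lemma nn_integral_indep_mult:
  assumes M: "prob_space M" and indep: "mutually_indep M [gen_sets M N1 X, gen_sets M N2 Y]"
    and [measurable]: "X \<in> M \<rightarrow>\<^sub>M N1" "Y \<in> M \<rightarrow>\<^sub>M N2" "f \<in> borel_measurable N1" "g \<in> borel_measurable N2"
  shows "(\<integral>\<^sup>+\<omega>. f (X \<omega>) * g (Y \<omega>) \<partial>M) = (\<integral>\<^sup>+\<omega>. f (X \<omega>) \<partial>M) * (\<integral>\<^sup>+\<omega>. g (Y \<omega>) \<partial>M)"
proof -
  have "(\<integral>\<^sup>+\<omega>. f (X \<omega>) * g (Y \<omega>) \<partial>M) = (\<integral>\<^sup>+\<omega>. \<integral>\<^sup>+\<omega>'. f (X \<omega>) * g (Y \<omega>') \<partial>M \<partial>M)"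
  proof (rule nn_integral_pair_indep(1)[OF M indep, where f = "\<lambda>x y. f x * g y" and ?N2.0 = N2])
    show "Y \<in> sigma (space M) (\<Union>(set [gen_sets M N2 Y])) \<rightarrow>\<^sub>M N2"
      by (intro measurable_gen_sets) (simp_all add: gen_sets_subset_Pow)
  qed (simp_all add: gen_sets_Int_stable)
  also have "\<dots> = (\<integral>\<^sup>+\<omega>. f (X \<omega>) * (\<integral>\<^sup>+\<omega>'. g (Y \<omega>') \<partial>M) \<partial>M)"
    by (intro nn_integral_cong nn_integral_cmult) measurable
  also have "\<dots> = (\<integral>\<^sup>+\<omega>. f (X \<omega>) \<partial>M) * (\<integral>\<^sup>+\<omega>. g (Y \<omega>) \<partial>M)"
    by (rule nn_integral_multc) measurable
  finally show ?thesis .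
qed

lemma measurable_d2d_interference [measurable]:
  "d2d_interference \<beta> PD \<in> borel_measurable (config_space (borel \<Otimes>\<^sub>M fading_law))"
  unfolding d2d_interference_def by (rule measurable_point_sum') measurable

lemma measurable_uplink_interference [measurable]:
  "uplink_interference \<alpha> rhob \<in> borel_measurable (config_space (borel \<Otimes>\<^sub>M (user_power_law \<alpha>' lamB rhob' \<Otimes>\<^sub>M fading_law)))"
  unfolding uplink_interference_def by (rule measurable_point_sum') measurable

lemma measurable_downlink_interference:
  "(\<lambda>(r, \<phi>). downlink_interference \<alpha> PB r \<phi>) \<in> borel_measurable (borel \<Otimes>\<^sub>M config_space (borel \<Otimes>\<^sub>M fading_law))"
  unfolding downlink_interference_def by (rule measurable_point_sum) measurable

lemma measurable_downlink_interference' [measurable (raw)]: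
  assumes [measurable]: "r \<in> borel_measurable N" "\<phi> \<in> N \<rightarrow>\<^sub>M config_space (borel \<Otimes>\<^sub>M fading_law)"
  shows "(\<lambda>x. downlink_interference \<alpha> PB (r x) (\<phi> x)) \<in> borel_measurable N"
  using measurable_compose[of "\<lambda>x. (r x, \<phi> x)" N _ _ borel, OF _ measurable_downlink_interference[of \<alpha> PB]] by simp

text \<open>The Laplace exponent of the D2D interference per unit intensity, where \<open>A\<close>
  is the transmit power times the transform argument.\<close>

definition d2d_exponent :: "real \<Rightarrow> real \<Rightarrow> real" where
  "d2d_exponent \<beta> A = 2 * pi\<^sup>2 * A powr (2 / \<beta>) / (\<beta> * sin (2 * pi / \<beta>))"

lemma d2d_exponent_nonneg: "2 < \<beta> \<Longrightarrow> 0 \<le> d2d_exponent \<beta> A"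
  unfolding d2d_exponent_def by (intro divide_nonneg_nonneg mult_nonneg_nonneg sin_ge_zero) (auto simp: field_simps)

text \<open>Equality of the path-loss exponents acts here: the inverse signal contributes r^\<alpha>
  to the argument, and the power 2/\<beta> turns it into r^2, matching the cellular part.\<close>

lemma d2d_exponent_mult_powr:
  assumes "0 < \<beta>" "0 < A" "0 < r"
  shows "d2d_exponent \<beta> (A * r powr \<beta>) = d2d_exponent \<beta> A * r\<^sup>2"
  using assms by (simp add: d2d_exponent_def powr_mult powr_powr powr_numeral)

text \<open>Given the serving distance, the cellular and D2D transforms multiply, and both exponents
  are multiples of its square. The remaining average is a single Laplace transform of an exponential
  variable.\<close>

lemma downlink_coverage:
  assumes model: "downlink_model M lamB lamI lamT h r0 \<Phi> \<Psi>"
    and "2 < \<alpha>" "0 < \<tau>" "0 < PB" "0 < PD" "0 < lamB" "0 \<le> lamI" "0 \<le> lamT"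
  shows "emeasure M {\<omega> \<in> space M. ennreal \<tau> < downlink_sinr \<alpha> \<alpha> PB PD shared (h \<omega>) (r0 \<omega>) (\<Phi> \<omega>) (\<Psi> \<omega>)} =
    ennreal (pi * lamB / (pi * lamB + (lamI * pi * exclusion_const \<alpha> \<tau> +
      (if shared then lamT * d2d_exponent \<alpha> (\<tau> * PD / PB) else 0))))"
    (is "emeasure M ?S = ennreal (pi * lamB / (pi * lamB + ?C))")
proof -
  let ?CS = "config_space (borel \<Otimes>\<^sub>M fading_law) :: ((real ^ 2) \<times> real) config measure"
  have M: "prob_space M" and h [measurable]: "h \<in> borel_measurable M" and h_law: "distr M borel h = fading_law"
    and r0 [measurable]: "r0 \<in> borel_measurable M" and r0_law: "distr M borel r0 = nearest_bs_law lamB"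
    and \<Phi>_ppp: "marked_ppp M lamI fading_law \<Phi>" and \<Psi>_ppp: "marked_ppp M lamT fading_law \<Psi>"
    and indep: "mutually_indep M [gen_sets M borel h, gen_sets M borel r0, gen_sets M ?CS \<Phi>, gen_sets M ?CS \<Psi>]"
    using model by (auto simp: downlink_model_def)
  have \<Phi> [measurable]: "\<Phi> \<in> M \<rightarrow>\<^sub>M ?CS" and \<Psi> [measurable]: "\<Psi> \<in> M \<rightarrow>\<^sub>M ?CS"
    using \<Phi>_ppp \<Psi>_ppp by (auto simp: marked_ppp_def)
  note indep2 = mutually_indep_tl[OF M indep]
  note indep3 = mutually_indep_tl[OF M indep2]
  have r0_pos: "AE \<omega> in M. 0 < r0 \<omega>"
    using AE_nearest_bs_law_pos[of lamB] unfolding r0_law[symmetric] by (subst (asm) AE_distr_iff) auto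
  define D where "D \<psi> = (if shared then d2d_interference \<alpha> PD \<psi> else 0)" for \<psi> :: "((real ^ 2) \<times> real) config"
  have [measurable]: "D \<in> borel_measurable ?CS" unfolding D_def by measurable
  define \<kappa> where "\<kappa> r = PB * r powr - \<alpha>" for r
  have [measurable]: "\<kappa> \<in> borel_measurable borel" unfolding \<kappa>_def by measurable
  define G where "G r z = expm (ennreal (\<tau> / \<kappa> r) * (downlink_interference \<alpha> PB r (fst z) + D (snd z)))"
    for r and z :: "((real ^ 2) \<times> real) config \<times> ((real ^ 2) \<times> real) config"
  have "emeasure M ?S = emeasure M {\<omega> \<in> space M. ennreal \<tau> <
      sinr (ennreal (\<kappa> (fst (r0 \<omega>, \<Phi> \<omega>, \<Psi> \<omega>)) * h \<omega>))
        ((\<lambda>z. downlink_interference \<alpha> PB (fst z) (fst (snd z)) + D (snd (snd z))) (r0 \<omega>, \<Phi> \<omega>, \<Psi> \<omega>))}"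
    by (simp add: downlink_sinr_def D_def \<kappa>_def mult_ac)
  also have "\<dots> = (\<integral>\<^sup>+\<omega>. expm (ennreal (\<tau> / \<kappa> (fst (r0 \<omega>, \<Phi> \<omega>, \<Psi> \<omega>))) *
        ((\<lambda>z. downlink_interference \<alpha> PB (fst z) (fst (snd z)) + D (snd (snd z))) (r0 \<omega>, \<Phi> \<omega>, \<Psi> \<omega>))) \<partial>M)"
  proof (rule coverage_probability[where N = "borel \<Otimes>\<^sub>M ?CS \<Otimes>\<^sub>M ?CS" and \<kappa> = "\<lambda>z. \<kappa> (fst z)", OF M indep h h_law])
    show "(\<lambda>\<omega>. (r0 \<omega>, \<Phi> \<omega>, \<Psi> \<omega>)) \<in> sigma (space M) (\<Union>(set [gen_sets M borel r0, gen_sets M ?CS \<Phi>, gen_sets M ?CS \<Psi>]))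
        \<rightarrow>\<^sub>M borel \<Otimes>\<^sub>M ?CS \<Otimes>\<^sub>M ?CS"
      by (intro measurable_Pair measurable_gen_sets r0 \<Phi> \<Psi>) (simp_all add: gen_sets_subset_Pow)
    show "AE \<omega> in M. 0 < \<kappa> (fst (r0 \<omega>, \<Phi> \<omega>, \<Psi> \<omega>))"
      using r0_pos by eventually_elim (use \<open>0 < PB\<close> in \<open>simp add: \<kappa>_def\<close>)
  qed (use assms in \<open>simp_all add: gen_sets_Int_stable\<close>)
  also have "\<dots> = (\<integral>\<^sup>+\<omega>. G (r0 \<omega>) (\<Phi> \<omega>, \<Psi> \<omega>) \<partial>M)"
    by (simp add: G_def)
  also have "\<dots> = (\<integral>\<^sup>+\<omega>. \<integral>\<^sup>+\<omega>'. G (r0 \<omega>) (\<Phi> \<omega>', \<Psi> \<omega>') \<partial>M \<partial>M)"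
  proof (rule nn_integral_pair_indep(1)[OF M indep2 r0, where f = G and ?N2.0 = "?CS \<Otimes>\<^sub>M ?CS"])
    show "(\<lambda>\<omega>. (\<Phi> \<omega>, \<Psi> \<omega>)) \<in> sigma (space M) (\<Union>(set [gen_sets M ?CS \<Phi>, gen_sets M ?CS \<Psi>])) \<rightarrow>\<^sub>M ?CS \<Otimes>\<^sub>M ?CS"
      by (intro measurable_Pair measurable_gen_sets \<Phi> \<Psi>) (simp_all add: gen_sets_subset_Pow)
    show "(\<lambda>(r, z). G r z) \<in> borel_measurable (borel \<Otimes>\<^sub>M ?CS \<Otimes>\<^sub>M ?CS)"
      unfolding G_def by measurable
  qed (simp_all add: gen_sets_Int_stable)
  \<comment> \<open>With the distance frozen, the two independent processes contribute one summand
    of the constant each.\<close>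
  also have "\<dots> = (\<integral>\<^sup>+\<omega>. expm (ennreal (?C * (r0 \<omega>)\<^sup>2)) \<partial>M)"
  proof (intro nn_integral_cong_AE, use r0_pos in eventually_elim)
    case (elim \<omega>)
    define r where "r = r0 \<omega>"
    have r: "0 < r" using elim by (simp add: r_def)
    define c where "c = \<tau> * r powr \<alpha> / PB"
    have c: "0 < c" "\<tau> / \<kappa> r = c" using r assms by (simp_all add: c_def \<kappa>_def powr_minus field_simps)
    have "(\<integral>\<^sup>+\<omega>'. G r (\<Phi> \<omega>', \<Psi> \<omega>') \<partial>M) =
        (\<integral>\<^sup>+\<omega>'. expm (ennreal c * downlink_interference \<alpha> PB r (\<Phi> \<omega>')) * expm (ennreal c * D (\<Psi> \<omega>')) \<partial>M)"
      by (simp add: G_def c(2) expm_add distrib_left)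
    also have "\<dots> = (\<integral>\<^sup>+\<omega>'. expm (ennreal c * downlink_interference \<alpha> PB r (\<Phi> \<omega>')) \<partial>M) *
        (\<integral>\<^sup>+\<omega>'. expm (ennreal c * D (\<Psi> \<omega>')) \<partial>M)"
      by (rule nn_integral_indep_mult[OF M indep3]) measurable
    also have "(\<integral>\<^sup>+\<omega>'. expm (ennreal c * downlink_interference \<alpha> PB r (\<Phi> \<omega>')) \<partial>M) =
        expm (ennreal lamI * ennreal (pi * r\<^sup>2 * exclusion_const \<alpha> \<tau>))"
      unfolding c_def by (rule laplace_downlink_interference[OF \<Phi>_ppp]) fact+
    also have "\<dots> = expm (ennreal (lamI * pi * exclusion_const \<alpha> \<tau> * r\<^sup>2))"
      using assms exclusion_const_nonneg[of \<alpha> \<tau>] by (simp add: mult_ac flip: ennreal_mult)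
    also have "(\<integral>\<^sup>+\<omega>'. expm (ennreal c * D (\<Psi> \<omega>')) \<partial>M) =
        expm (ennreal ((if shared then lamT * d2d_exponent \<alpha> (\<tau> * PD / PB) else 0) * r\<^sup>2))"
    proof (cases shared)
      case True
      have cPD: "c * PD = \<tau> * PD / PB * r powr \<alpha>" by (simp add: c_def)
      have "(\<integral>\<^sup>+\<omega>'. expm (ennreal c * D (\<Psi> \<omega>')) \<partial>M) = expm (ennreal lamT * ennreal (d2d_exponent \<alpha> (c * PD)))"
        using laplace_d2d_interference[OF \<Psi>_ppp \<open>2 < \<alpha>\<close> c(1) \<open>0 < PD\<close>] True by (simp add: D_def d2d_exponent_def)
      also have "d2d_exponent \<alpha> (c * PD) = d2d_exponent \<alpha> (\<tau> * PD / PB) * r\<^sup>2"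
        unfolding cPD using assms r by (intro d2d_exponent_mult_powr) auto
      finally show ?thesis
        using True assms d2d_exponent_nonneg[of \<alpha> "\<tau> * PD / PB"] by (simp add: mult_ac flip: ennreal_mult)
    qed (simp add: D_def prob_space.emeasure_space_1[OF M])
    also have "expm (ennreal (lamI * pi * exclusion_const \<alpha> \<tau> * r\<^sup>2)) * \<dots> = expm (ennreal (?C * r\<^sup>2))"
      using assms exclusion_const_nonneg[of \<alpha> \<tau>] d2d_exponent_nonneg[of \<alpha> "\<tau> * PD / PB"]
      unfolding expm_add[symmetric] distrib_right by (subst ennreal_plus) auto
    finally show ?case by (simp only: r_def)
  qed
  also have "\<dots> = (\<integral>\<^sup>+r. expm (ennreal (?C * r\<^sup>2)) \<partial>nearest_bs_law lamB)"
    unfolding r0_law[symmetric] by (subst nn_integral_distr) auto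
  also have "\<dots> = ennreal (pi * lamB / (pi * lamB + ?C))"
    using assms exclusion_const_nonneg[of \<alpha> \<tau>] d2d_exponent_nonneg[of \<alpha> "\<tau> * PD / PB"]
    by (intro nearest_bs_law_expm) auto
  finally show ?thesis .
qed

text \<open>Channel inversion fixes the mean received signal at \<open>rhob\<close>, so the
  transform argument is constant and no average over a serving distance remains. Hence the pure
  exponential.\<close>

lemma uplink_coverage:
  assumes model: "uplink_model M lamI (user_power_law \<alpha> lamB rhob) lamT h \<Phi> \<Psi>"
    and "2 < \<alpha>" "0 < \<tau>" "0 < rhob" "0 < PD" "0 < lamB" "0 \<le> lamI" "0 \<le> lamT"
  shows "emeasure M {\<omega> \<in> space M. ennreal \<tau> < uplink_sinr \<alpha> \<alpha> rhob PD shared (h \<omega>) (\<Phi> \<omega>) (\<Psi> \<omega>)} =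
    ennreal (exp (- (lamI / lamB * exclusion_const \<alpha> \<tau> +
      (if shared then lamT * d2d_exponent \<alpha> (\<tau> * PD / rhob) else 0))))"
    (is "emeasure M ?S = ennreal (exp (- ?C))")
proof -
  let ?CS = "config_space (borel \<Otimes>\<^sub>M fading_law) :: ((real ^ 2) \<times> real) config measure"
  let ?CU = "config_space (borel \<Otimes>\<^sub>M (user_power_law \<alpha> lamB rhob \<Otimes>\<^sub>M fading_law)) :: ((real ^ 2) \<times> real \<times> real) config measure"
  have M: "prob_space M" and h [measurable]: "h \<in> borel_measurable M" and h_law: "distr M borel h = fading_law"
    and \<Phi>_ppp: "marked_ppp M lamI (user_power_law \<alpha> lamB rhob \<Otimes>\<^sub>M fading_law) \<Phi>"
    and \<Psi>_ppp: "marked_ppp M lamT fading_law \<Psi>"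
    and indep: "mutually_indep M [gen_sets M borel h, gen_sets M ?CU \<Phi>, gen_sets M ?CS \<Psi>]"
    using model by (auto simp: uplink_model_def)
  have \<Phi> [measurable]: "\<Phi> \<in> M \<rightarrow>\<^sub>M ?CU" and \<Psi> [measurable]: "\<Psi> \<in> M \<rightarrow>\<^sub>M ?CS"
    using \<Phi>_ppp \<Psi>_ppp by (auto simp: marked_ppp_def)
  note indep2 = mutually_indep_tl[OF M indep]
  define D where "D \<psi> = (if shared then d2d_interference \<alpha> PD \<psi> else 0)" for \<psi> :: "((real ^ 2) \<times> real) config"
  have [measurable]: "D \<in> borel_measurable ?CS" unfolding D_def by measurable
  define c where "c = \<tau> / rhob"
  have c: "0 < c" using assms by (simp add: c_def)
  have "emeasure M ?S = emeasure M {\<omega> \<in> space M. ennreal \<tau> <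
      sinr (ennreal (rhob * h \<omega>)) ((\<lambda>z. uplink_interference \<alpha> rhob (fst z) + D (snd z)) (\<Phi> \<omega>, \<Psi> \<omega>))}"
    by (simp add: uplink_sinr_def D_def)
  also have "\<dots> = (\<integral>\<^sup>+\<omega>. expm (ennreal (\<tau> / rhob) *
      ((\<lambda>z. uplink_interference \<alpha> rhob (fst z) + D (snd z)) (\<Phi> \<omega>, \<Psi> \<omega>))) \<partial>M)"
  proof (rule coverage_probability[where N = "?CU \<Otimes>\<^sub>M ?CS" and \<kappa> = "\<lambda>z. rhob", OF M indep h h_law])
    show "(\<lambda>\<omega>. (\<Phi> \<omega>, \<Psi> \<omega>)) \<in> sigma (space M) (\<Union>(set [gen_sets M ?CU \<Phi>, gen_sets M ?CS \<Psi>])) \<rightarrow>\<^sub>M ?CU \<Otimes>\<^sub>M ?CS"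
      by (intro measurable_Pair measurable_gen_sets \<Phi> \<Psi>) (simp_all add: gen_sets_subset_Pow)
  qed (use assms in \<open>simp_all add: gen_sets_Int_stable\<close>)
  also have "\<dots> = (\<integral>\<^sup>+\<omega>. expm (ennreal c * uplink_interference \<alpha> rhob (\<Phi> \<omega>)) * expm (ennreal c * D (\<Psi> \<omega>)) \<partial>M)"
    by (simp add: c_def expm_add distrib_left)
  also have "\<dots> = (\<integral>\<^sup>+\<omega>. expm (ennreal c * uplink_interference \<alpha> rhob (\<Phi> \<omega>)) \<partial>M) *
      (\<integral>\<^sup>+\<omega>. expm (ennreal c * D (\<Psi> \<omega>)) \<partial>M)"
    by (rule nn_integral_indep_mult[OF M indep2]) measurable
  also have "(\<integral>\<^sup>+\<omega>. expm (ennreal c * uplink_interference \<alpha> rhob (\<Phi> \<omega>)) \<partial>M) =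
      expm (ennreal lamI * ennreal (exclusion_const \<alpha> \<tau> / lamB))"
    unfolding c_def by (rule laplace_uplink_interference[OF \<Phi>_ppp]) fact+
  also have "\<dots> = expm (ennreal (lamI / lamB * exclusion_const \<alpha> \<tau>))"
    using assms exclusion_const_nonneg[of \<alpha> \<tau>] by (simp flip: ennreal_mult)
  also have "(\<integral>\<^sup>+\<omega>. expm (ennreal c * D (\<Psi> \<omega>)) \<partial>M) =
      expm (ennreal (if shared then lamT * d2d_exponent \<alpha> (\<tau> * PD / rhob) else 0))"
  proof (cases shared)
    case True
    have "(\<integral>\<^sup>+\<omega>. expm (ennreal c * D (\<Psi> \<omega>)) \<partial>M) = expm (ennreal lamT * ennreal (d2d_exponent \<alpha> (c * PD)))"
      using laplace_d2d_interference[OF \<Psi>_ppp \<open>2 < \<alpha>\<close> c(1) \<open>0 < PD\<close>] True by (simp add: D_def d2d_exponent_def)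
    thus ?thesis
      using True assms d2d_exponent_nonneg[of \<alpha> "\<tau> * PD / rhob"] by (simp add: c_def flip: ennreal_mult)
  qed (simp add: D_def prob_space.emeasure_space_1[OF M])
  also have "expm (ennreal (lamI / lamB * exclusion_const \<alpha> \<tau>)) * \<dots> = expm (ennreal ?C)"
    using assms exclusion_const_nonneg[of \<alpha> \<tau>] d2d_exponent_nonneg[of \<alpha> "\<tau> * PD / rhob"]
    unfolding expm_add[symmetric] by (subst ennreal_plus) auto
  also have "\<dots> = ennreal (exp (- ?C))"
    using assms exclusion_const_nonneg[of \<alpha> \<tau>] d2d_exponent_nonneg[of \<alpha> "\<tau> * PD / rhob"]
    by (intro expm_ennreal) auto
  finally show ?thesis .
qed

text \<open>Measurability of the event follows from \<open>v > 0\<close>: \<open>emeasure\<close> vanishes on non-measurable sets.\<close>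

lemma outage_from_coverage:
  assumes "prob_space M" "0 < v" "emeasure M {\<omega> \<in> space M. t < S \<omega>} = ennreal v"
  shows "measure M {\<omega> \<in> space M. S \<omega> \<le> (t :: ennreal)} = 1 - v"
proof -
  interpret prob_space M by fact
  have "{\<omega> \<in> space M. t < S \<omega>} \<in> events"
    using assms by (intro emeasure_neq_0_sets) auto
  moreover have "{\<omega> \<in> space M. S \<omega> \<le> t} = space M - {\<omega> \<in> space M. t < S \<omega>}" by auto
  moreover have "prob {\<omega> \<in> space M. t < S \<omega>} = v"
    using assms by (simp add: measure_def)
  ultimately show ?thesis by (simp add: prob_compl)
qed

theorem theorem2:
  fixes lamB lamU lamD PB rhob rhod \<gamma> d\<^sub>o \<alpha> \<beta> a \<tau> :: real
    and pol :: policy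
    and CD CU :: "'c set" and cd c :: 'c
    and qc qd qhat qD qU PD pf ps K2 K3 :: real
    and Pu :: "real measure"
    and S :: "'s measure" and \<Phi>S :: "'s \<Rightarrow> ((real ^ 2) \<times> real \<times> real) config"
    and H :: "'h measure"
    and \<Phi>B :: "'h \<Rightarrow> ((real ^ 2) \<times> ('c \<Rightarrow> real)) config"
    and \<Phi>U :: "'h \<Rightarrow> ((real ^ 2) \<times> real \<times> real) config"
    and M :: "'w measure" and h r0 :: "'w \<Rightarrow> real"
    and \<Phi>down :: "'w \<Rightarrow> ((real ^ 2) \<times> real) config"
    and \<Phi>up :: "'w \<Rightarrow> ((real ^ 2) \<times> real \<times> real) config"
    and \<Psi> :: "'w \<Rightarrow> ((real ^ 2) \<times> real) config"
    and SINR :: "'w \<Rightarrow> ennreal"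
  assumes "lamB > 0" "lamU > 0" "lamD > 0" "PB > 0" "rhob > 0" "rhod > 0" "\<gamma> > 0" "d\<^sub>o > 0"
    and "\<alpha> > 2" "\<beta> > 2" "\<alpha> = \<beta>" "0 < a" "a \<le> 1" "\<tau> > 0"
    and "finite CD" "finite CU" "CD \<inter> CU = {}" "card (CD \<union> CU) \<ge> 2"
    and "cd \<in> CD \<union> CU" "c \<in> CD \<union> CU"
    and "qc = access_prob_other pol lamB lamU (card (CD \<union> CU))"
    and "qd = access_prob_d2d pol lamB lamU (card (CD \<union> CU))"
    and "qhat = (if c = cd then qd else qc)"
    and "qD = uniform_access_prob lamB lamU (card CD)"
    and "qU = uniform_access_prob lamB lamU (card CU)"
    and "Pu = user_power_law \<alpha> lamB rhob"
    and "PD = rhod * d\<^sub>o powr \<beta>"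
    and "sensing_model S (qd * lamB) (if cd \<in> CD then return borel PB else Pu) \<Phi>S"
    and "pf = measure S {\<omega> \<in> space S. channel_free \<alpha> \<gamma> (\<Phi>S \<omega>)}"
    and "harvesting_model H (qD * lamB) CD (qU * real (card CU) * lamB) Pu \<Phi>B \<Phi>U"
    and "ps = measure H {\<omega> \<in> space H. harvested_power a \<alpha> PB CD (\<Phi>B \<omega>) (\<Phi>U \<omega>) > ennreal PD}"
    and "c \<in> CD \<Longrightarrow> downlink_model M lamB (qhat * lamB) (ps * pf * lamD) h r0 \<Phi>down \<Psi>"
    and "c \<in> CU \<Longrightarrow> uplink_model M (qhat * lamB) Pu (ps * pf * lamD) h \<Phi>up \<Psi>"
    and "SINR = (\<lambda>\<omega>. if c \<in> CD then downlink_sinr \<alpha> \<beta> PB PD (c = cd) (h \<omega>) (r0 \<omega>) (\<Phi>down \<omega>) (\<Psi> \<omega>)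
                      else uplink_sinr \<alpha> \<beta> rhob PD (c = cd) (h \<omega>) (\<Phi>up \<omega>) (\<Psi> \<omega>))"
    and "K2 = 2 * qhat / (\<alpha> - 2) * G_fun ((1 / \<tau>) powr (1 / \<alpha>)) \<alpha> * \<tau> powr (2 / \<alpha>)"
    and "K3 = 2 * pi\<^sup>2 * ps * pf * lamD * d\<^sub>o\<^sup>2 / (\<beta> * sin (2 * pi / \<beta>)) * \<tau> powr (2 / \<beta>) *
              (if c = cd then 1 else 0)"
  shows "measure M {\<omega> \<in> space M. SINR \<omega> \<le> ennreal \<tau>} =
           (if c \<in> CD
            then 1 - pi * lamB / (pi * lamB * (1 + K2) + (rhod / PB) powr (2 / \<beta>) * K3)
            else 1 - exp (- (K2 + (rhod / rhob) powr (2 / \<beta>) * K3)))"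
proof -
  have lam: "lamB > 0" "lamU > 0" "lamD > 0" and pos: "PB > 0" "rhob > 0" "rhod > 0" "d\<^sub>o > 0" "\<tau> > 0"
    and \<alpha>: "\<alpha> > 2" and \<beta>: "\<beta> = \<alpha>"
    using assms(1-14) by auto
  have PD: "PD = rhod * d\<^sub>o powr \<alpha>" "PD > 0"
    using \<open>PD = rhod * d\<^sub>o powr \<beta>\<close> pos by (auto simp: \<beta>)
  \<comment> \<open>Nonnegative intensities are required by both coverage formulas; the next fact
    supplies the D2D one, as \<open>ps\<close> and \<open>pf\<close> are measures of events.\<close>
  have qhat: "0 \<le> qhat"
    using access_prob_nonneg[OF lam(1,2) \<open>card (CD \<union> CU) \<ge> 2\<close>, of pol]
      \<open>qc = _\<close> \<open>qd = _\<close> \<open>qhat = _\<close> by simp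
  have lamT: "0 \<le> ps * pf * lamD"
    using \<open>ps = _\<close> \<open>pf = _\<close> lam by simp
  have K2: "K2 = qhat * exclusion_const \<alpha> \<tau>"
  proof -
    have "K2 = 2 * qhat / (\<alpha> - 2) * (G_fun ((1 / \<tau>) powr (1 / \<alpha>)) \<alpha> * \<tau> powr (2 / \<alpha>))"
      using \<open>K2 = _\<close> by (simp only: mult.assoc)
    thus ?thesis
      unfolding G_fun_eq[OF \<alpha> pos(5)] by (simp add: exclusion_const_def)
  qed
  \<comment> \<open>Here \<open>p\<close> is \<open>PB\<close> or \<open>rhob\<close>. Raising the
    D2D power to 2/\<alpha> turns the path-loss factor into the square of \<open>d\<^sub>o\<close>,
    which accounts for that factor of \<open>K3\<close>.\<close>
  have K3: "(rhod / p) powr (2 / \<beta>) * K3 = (if c = cd then ps * pf * lamD * d2d_exponent \<alpha> (\<tau> * PD / p) else 0)"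
    if "0 < p" for p
  proof -
    have "(d\<^sub>o powr \<alpha>) powr (2 / \<alpha>) = d\<^sub>o\<^sup>2"
      using \<alpha> pos by (simp add: powr_powr powr_numeral)
    moreover have "\<tau> * PD / p = \<tau> * (rhod / p * d\<^sub>o powr \<alpha>)" by (simp add: PD)
    ultimately have "(\<tau> * PD / p) powr (2 / \<alpha>) = \<tau> powr (2 / \<alpha>) * ((rhod / p) powr (2 / \<alpha>) * d\<^sub>o\<^sup>2)"
      using pos that by (simp add: powr_mult powr_divide)
    thus ?thesis
      unfolding \<open>K3 = _\<close> d2d_exponent_def \<beta> by simp
  qed
  have nonneg: "0 \<le> K2" "0 \<le> (rhod / p) powr (2 / \<beta>) * K3" if "0 < p" for p
    unfolding K2 K3[OF that] using qhat lamT exclusion_const_nonneg[OF \<alpha> pos(5)] d2d_exponent_nonneg[OF \<alpha>]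
    by auto
  show ?thesis
  proof (cases "c \<in> CD")
    case True
    have model: "downlink_model M lamB (qhat * lamB) (ps * pf * lamD) h r0 \<Phi>down \<Psi>"
      using True by (rule assms)
    define v where "v = pi * lamB / (pi * lamB * (1 + K2) + (rhod / PB) powr (2 / \<beta>) * K3)"
    \<comment> \<open>The interferer intensity is \<open>qhat * lamB\<close>, so the cellular term
      carries \<pi> \<open>lamB\<close> and joins the leading summand as 1 +
      \<open>K2\<close>.\<close>
    have "pi * lamB * (1 + K2) + (rhod / PB) powr (2 / \<beta>) * K3 =
        pi * lamB + (qhat * lamB * pi * exclusion_const \<alpha> \<tau> +
          (if c = cd then ps * pf * lamD * d2d_exponent \<alpha> (\<tau> * PD / PB) else 0))"
      unfolding K3[OF pos(1)] unfolding K2 by (simp add: algebra_simps)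
    hence "emeasure M {\<omega> \<in> space M. ennreal \<tau> < SINR \<omega>} = ennreal v"
      unfolding v_def \<open>SINR = _\<close>
      using downlink_coverage[OF model \<alpha> pos(5,1) PD(2) lam(1), of "c = cd"] qhat lam lamT True by (simp add: \<beta>)
    moreover have "0 < v"
      unfolding v_def using lam nonneg[OF pos(1)] by (intro divide_pos_pos add_pos_nonneg mult_pos_pos) auto
    moreover have "prob_space M" using model by (simp add: downlink_model_def)
    ultimately show ?thesis
      using True outage_from_coverage[of M v "ennreal \<tau>" SINR] by (simp add: v_def)
  next
    case False
    \<comment> \<open>A channel outside \<open>CD\<close> lies in \<open>CU\<close>, since
      \<open>c\<close> belongs to their union.\<close>
    have model: "uplink_model M (qhat * lamB) (user_power_law \<alpha> lamB rhob) (ps * pf * lamD) h \<Phi>up \<Psi>"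
      using assms False by simp
    define v where "v = exp (- (K2 + (rhod / rhob) powr (2 / \<beta>) * K3))"
    have "emeasure M {\<omega> \<in> space M. ennreal \<tau> < SINR \<omega>} = ennreal v"
      unfolding v_def K3[OF pos(2)] K2 \<open>SINR = _\<close>
      using uplink_coverage[OF model \<alpha> pos(5,2) PD(2) lam(1), of "c = cd"] qhat lam lamT False by (simp add: \<beta>)
    moreover have "prob_space M" using model by (simp add: uplink_model_def)
    ultimately show ?thesis
      using False outage_from_coverage[of M v "ennreal \<tau>" SINR] by (simp add: v_def)
  qed
qed

end
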